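(* Let $G$ be a lacunary hyperbolic group with a fixed approximating sequence $(G_k,S_k)_{k\in\mathbb{N}}$ as described in the context. For every endomorphism $\phi$ of $G$, there exists an integer $n$ such that $\phi$ coherently lifts from step $n$. In other words, $$\mathrm{Mor}(G)=\bigcup_{n\in\mathbb{N}}\mathrm{Mor}_n(G)\quad\text{and}\quad \mathrm{OMor}(G)=\bigcup_{n\in\mathbb{N}}\mathrm{OMor}_n(G).$$
   Context: Setting: $G$ is a lacunary hyperbolic group with a finite generating set $S$ for which $(G,S)$ is the direct limit of a sequence of groups with finite generating sets and epimorphisms $\alpha_k\colon(G_k,S_k)\to(G_{k+1},S_{k+1})$, $k\in\mathbb{N}$, with $\alpha_k(S_k)=S_{k+1}$, such that: (1) the Cayley graph of $G_k$ with respect to $S_k$ is $\delta_k$-hyperbolic ($\delta_k>0$; every side of a geodesic triangle lies in the $\delta_k$-neighbourhood of the union of the other two); (2) $\lim_{k\to\infty}\mathrm{inj}(\eta_k)/\delta_k=\infty$, where $\eta_k\colon G_k\to G$ is the natural epimorphism (so $\eta_k(S_k)=S$) and $\mathrm{inj}(\eta_k)\in\mathbb{N}\cup\{\infty\}$ is the largest $R$ such that $\eta_k$ is injective on every ball of radius $R$ of $G_k$ for the word metric of $S_k$. (Existence of such a sequence characterizes lacunary hyperbolic groups.) Moreover $G_0$ is a free group with basis $S_0$. Denote by $\pi_k\colon G_0\to G_k$ the natural epimorphism. $\mathrm{Mor}(G)$ is the semigroup of endomorphisms of $G$. For $g\in G$, $\iota_g$ is the inner automorphism $x\mapsto gxg^{-1}$.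 $\mathrm{OMor}(G)$ is the quotient of $\mathrm{Mor}(G)$ identifying $\phi_1$ and $\phi_2$ if $\phi_1=\iota_g\circ\phi_2$ for some $g\in G$. For $n\in\mathbb{N}$, $\phi\in\mathrm{Mor}(G)$ coherently lifts from step $n$ if there is an endomorphism $\tilde\phi_0$ of $G_0$ lifting $\phi$ (i.e. $\eta_0\circ\tilde\phi_0=\phi\circ\eta_0$) such that for every $k\ge n$, $\tilde\phi_0$ induces an endomorphism $\tilde\phi_k$ of $G_k$ (i.e. $\tilde\phi_k\circ\pi_k=\pi_k\circ\tilde\phi_0$). $\mathrm{Mor}_n(G)$ is the set of endomorphisms of $G$ that coherently lift from step $n$; it contains the inner automorphisms and is a semigroup, and $\mathrm{OMor}_n(G)\subset\mathrm{OMor}(G)$ is its image. *)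

theory Defs
  imports "HOL-Algebra.Algebra" "HOL-Library.Extended_Real"
begin

section \<open>Words in a subset of a group\<close>

text \<open>A word is a list of signed letters; \<open>(True, x)\<close> stands for $x$ and
  \<open>(False, x)\<close> for $x^{-1}$.\<close>

type_synonym 'a word = "(bool \<times> 'a) list"

definition words :: "'a set \<Rightarrow> 'a word set" where
  "words S = {w. snd ` set w \<subseteq> S}"

definition reduced :: "'a word \<Rightarrow> bool" where
  "reduced w \<longleftrightarrow> successively (\<lambda>(b, x) (c, y). \<not> (x = y \<and> b \<noteq> c)) w"

definition word_eval :: "('a, 'm) monoid_scheme \<Rightarrow> 'a word \<Rightarrow> 'a" where
  "word_eval G w = foldr (\<lambda>(b, x) g. (if b then x else inv\<^bsub>G\<^esub> x) \<otimes>\<^bsub>G\<^esub> g) w \<one>\<^bsub>G\<^esub>"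

definition free_group_with_basis :: "('a, 'm) monoid_scheme \<Rightarrow> 'a set \<Rightarrow> bool" where
  "free_group_with_basis G S \<longleftrightarrow> group G \<and> S \<subseteq> carrier G \<and>
     (\<forall>g\<in>carrier G. \<exists>!w. w \<in> words S \<and> reduced w \<and> word_eval G w = g)"

definition finite_generating_set :: "('a, 'm) monoid_scheme \<Rightarrow> 'a set \<Rightarrow> bool" where
  "finite_generating_set G S \<longleftrightarrow> finite S \<and> S \<subseteq> carrier G \<and> generate G S = carrier G"

definition word_length :: "('a, 'm) monoid_scheme \<Rightarrow> 'a set \<Rightarrow> 'a \<Rightarrow> nat" where
  "word_length G S g = (LEAST n. \<exists>w\<in>words S. length w = n \<and> word_eval G w = g)"

definition word_dist :: "('a, 'm) monoid_scheme \<Rightarrow> 'a set \<Rightarrow> 'a \<Rightarrow> 'a \<Rightarrow> nat" where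
  "word_dist G S g h = word_length G S (inv\<^bsub>G\<^esub> g \<otimes>\<^bsub>G\<^esub> h)"

definition word_ball :: "('a, 'm) monoid_scheme \<Rightarrow> 'a set \<Rightarrow> 'a \<Rightarrow> nat \<Rightarrow> 'a set" where
  "word_ball G S g R = {h \<in> carrier G. word_dist G S g h \<le> R}"


section \<open>The Cayley graph as a geodesic metric space\<close>

text \<open>The vertex set and the edges of the Cayley graph, given as sets of end points: singletons
  are vertices and $\{g, gs\}$ with $s \neq 1$ is an edge.  The graph is undirected, without
  loops or multiple edges (these do not change distances, and removing them can
  only make the hyperbolicity condition below weaker).\<close>

definition cayley_cells :: "('a, 'm) monoid_scheme \<Rightarrow> 'a set \<Rightarrow> 'a set set" where
  "cayley_cells G S =
     {{g} | g. g \<in> carrier G} \<union> {{g, g \<otimes>\<^bsub>G\<^esub> s} | g s. g \<in> carrier G \<and> s \<in> S}"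

definition support :: "('a \<Rightarrow> real) \<Rightarrow> 'a set" where
  "support p = {v. p v \<noteq> 0}"

text \<open>The geometric realization, in barycentric coordinates: the point at distance $t$ from $u$
  on an edge $\{u,v\}$ is the function with value $1-t$ at $u$, $t$ at $v$ and $0$ elsewhere.\<close>

definition cayley_graph :: "('a, 'm) monoid_scheme \<Rightarrow> 'a set \<Rightarrow> ('a \<Rightarrow> real) set" where
  "cayley_graph G S =
     {p. (\<forall>v. 0 \<le> p v) \<and> support p \<in> cayley_cells G S \<and> sum p (support p) = 1}"

text \<open>The path metric for which every edge has length one.  If $p$ and $q$ lie in the same open
  cell, the distance is measured inside it; otherwise a shortest path leaves the cell of $p$
  through an end point $u$ (at distance $1 - p(u)$ from $p$) and enters the cell of $q$ through
  an end point $v$.\<close>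

definition cayley_dist ::
    "('a, 'm) monoid_scheme \<Rightarrow> 'a set \<Rightarrow> ('a \<Rightarrow> real) \<Rightarrow> ('a \<Rightarrow> real) \<Rightarrow> real" where
  "cayley_dist G S p q =
     (if support p = support q then Max ((\<lambda>v. \<bar>p v - q v\<bar>) ` support p)
      else Min {(1 - p u) + real (word_dist G S u v) + (1 - q v) | u v.
                 u \<in> support p \<and> v \<in> support q})"

definition geodesic_segment ::
    "'x set \<Rightarrow> ('x \<Rightarrow> 'x \<Rightarrow> real) \<Rightarrow> 'x \<Rightarrow> 'x \<Rightarrow> 'x set \<Rightarrow> bool" where
  "geodesic_segment M d x y A \<longleftrightarrow>
     (\<exists>c. c ` {0..d x y} \<subseteq> M \<and> c 0 = x \<and> c (d x y) = y \<and>
          (\<forall>s\<in>{0..d x y}. \<forall>t\<in>{0..d x y}. d (c s) (c t) = \<bar>s - t\<bar>) \<and>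
          A = c ` {0..d x y})"

text \<open>It is enough to mention one side, since the vertices can be permuted cyclically.\<close>

definition hyperbolic_space :: "real \<Rightarrow> 'x set \<Rightarrow> ('x \<Rightarrow> 'x \<Rightarrow> real) \<Rightarrow> bool" where
  "hyperbolic_space \<delta> M d \<longleftrightarrow>
     (\<forall>x\<in>M. \<forall>y\<in>M. \<forall>z\<in>M. \<forall>A B C.
        geodesic_segment M d x y A \<longrightarrow> geodesic_segment M d y z B \<longrightarrow> geodesic_segment M d z x C \<longrightarrow>
        (\<forall>p\<in>A. \<exists>q\<in>B \<union> C. d p q \<le> \<delta>))"


section \<open>Direct limits and injectivity radius\<close>

primrec transition :: "(nat \<Rightarrow> 'a \<Rightarrow> 'a) \<Rightarrow> nat \<Rightarrow> nat \<Rightarrow> 'a \<Rightarrow> 'a" where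
  "transition \<alpha> k 0 = id"
| "transition \<alpha> k (Suc j) = \<alpha> (k + j) \<circ> transition \<alpha> k j"

text \<open>The usual concrete description of a direct limit of groups along a sequence; see
  \<open>direct_limit_universal\<close> for the universal property.\<close>

definition is_direct_limit ::
    "(nat \<Rightarrow> ('a, 'm) monoid_scheme) \<Rightarrow> (nat \<Rightarrow> 'a \<Rightarrow> 'a) \<Rightarrow>
     ('b, 'n) monoid_scheme \<Rightarrow> (nat \<Rightarrow> 'a \<Rightarrow> 'b) \<Rightarrow> bool" where
  "is_direct_limit Gr \<alpha> G \<eta> \<longleftrightarrow>
     (\<forall>k. \<eta> k \<in> hom (Gr k) G) \<and>
     (\<forall>k. \<forall>x\<in>carrier (Gr k). \<eta> (Suc k) (\<alpha> k x) = \<eta> k x) \<and>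
     carrier G = (\<Union>k. \<eta> k ` carrier (Gr k)) \<and>
     (\<forall>k. \<forall>x\<in>carrier (Gr k). \<forall>y\<in>carrier (Gr k).
        \<eta> k x = \<eta> k y \<longrightarrow> (\<exists>j. transition \<alpha> k j x = transition \<alpha> k j y))"

lemma transition_in_carrier:
  assumes "\<And>k. \<alpha> k \<in> hom (Gr k) (Gr (Suc k))" and "x \<in> carrier (Gr k)"
  shows "transition \<alpha> k j x \<in> carrier (Gr (k + j))"
  using assms(2) by (induction j) (auto intro: hom_in_carrier[OF assms(1)])

lemma transition_compatible:
  assumes "\<And>k. \<alpha> k \<in> hom (Gr k) (Gr (Suc k))"
    and "\<And>k x. x \<in> carrier (Gr k) \<Longrightarrow> \<theta> (Suc k) (\<alpha> k x) = \<theta> k x"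
    and "x \<in> carrier (Gr k)"
  shows "\<theta> (k + j) (transition \<alpha> k j x) = \<theta> k x"
proof (induction j)
  case (Suc j)
  show ?case
    using assms(2)[OF transition_in_carrier[of \<alpha> Gr, OF assms(1,3)]] Suc by simp
qed simp

lemma direct_limit_universal:
  assumes lim: "is_direct_limit Gr \<alpha> G \<eta>"
    and grp: "\<And>k. group (Gr k)"
    and \<alpha>: "\<And>k. \<alpha> k \<in> hom (Gr k) (Gr (Suc k))"
    and \<theta>: "\<And>k. \<theta> k \<in> hom (Gr k) H"
    and comp: "\<And>k x. x \<in> carrier (Gr k) \<Longrightarrow> \<theta> (Suc k) (\<alpha> k x) = \<theta> k x"
  shows "\<exists>!h. h \<in> hom G H \<inter> extensional (carrier G) \<and>
           (\<forall>k. \<forall>x\<in>carrier (Gr k). h (\<eta> k x) = \<theta> k x)"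
proof -
  have \<eta>: "\<And>k. \<eta> k \<in> hom (Gr k) G"
    and \<eta>comp: "\<And>k x. x \<in> carrier (Gr k) \<Longrightarrow> \<eta> (Suc k) (\<alpha> k x) = \<eta> k x"
    and surj: "carrier G = (\<Union>k. \<eta> k ` carrier (Gr k))"
    and inj: "\<And>k x y. x \<in> carrier (Gr k) \<Longrightarrow> y \<in> carrier (Gr k) \<Longrightarrow> \<eta> k x = \<eta> k y \<Longrightarrow>
                \<exists>j. transition \<alpha> k j x = transition \<alpha> k j y"
    using lim by (auto simp: is_direct_limit_def)
  note tc = transition_in_carrier[of \<alpha> Gr, OF \<alpha>]
  have common: "\<exists>u\<in>carrier (Gr (k + l)). \<exists>v\<in>carrier (Gr (k + l)).
      \<eta> (k + l) u = \<eta> k x \<and> \<theta> (k + l) u = \<theta> k x \<and> \<eta> (k + l) v = \<eta> l y \<and> \<theta> (k + l) v = \<theta> l y"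
    if "x \<in> carrier (Gr k)" "y \<in> carrier (Gr l)" for k l x y
  proof (intro bexI conjI)
    show "\<eta> (k + l) (transition \<alpha> k l x) = \<eta> k x" "\<theta> (k + l) (transition \<alpha> k l x) = \<theta> k x"
      using transition_compatible[of \<alpha> Gr \<eta>, OF \<alpha> \<eta>comp that(1)]
        transition_compatible[of \<alpha> Gr \<theta>, OF \<alpha> comp that(1)] by auto
    show "\<eta> (k + l) (transition \<alpha> l k y) = \<eta> l y" "\<theta> (k + l) (transition \<alpha> l k y) = \<theta> l y"
      using transition_compatible[of \<alpha> Gr \<eta>, OF \<alpha> \<eta>comp that(2), of k]
        transition_compatible[of \<alpha> Gr \<theta>, OF \<alpha> comp that(2), of k] by (auto simp: add.commute)
    show "transition \<alpha> k l x \<in> carrier (Gr (k + l))" using tc[OF that(1)] .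
    show "transition \<alpha> l k y \<in> carrier (Gr (k + l))" using tc[OF that(2), of k] by (simp add: add.commute)
  qed
  have wd0: "\<theta> k x = \<theta> k y" if "x \<in> carrier (Gr k)" "y \<in> carrier (Gr k)" "\<eta> k x = \<eta> k y" for k x y
    using inj[OF that] transition_compatible[of \<alpha> Gr \<theta>, OF \<alpha> comp that(1)]
      transition_compatible[of \<alpha> Gr \<theta>, OF \<alpha> comp that(2)] by metis
  have wd: "\<theta> k x = \<theta> l y" if "x \<in> carrier (Gr k)" "y \<in> carrier (Gr l)" "\<eta> k x = \<eta> l y" for k l x y
    using common[OF that(1,2)] that(3) wd0 by metis
  define h where "h = (\<lambda>g\<in>carrier G. THE z. \<exists>k. \<exists>x\<in>carrier (Gr k). g = \<eta> k x \<and> z = \<theta> k x)"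
  have h: "h (\<eta> k x) = \<theta> k x" if "x \<in> carrier (Gr k)" for k x
  proof -
    have "\<eta> k x \<in> carrier G" using surj that by auto
    moreover have "(THE z. \<exists>l. \<exists>y\<in>carrier (Gr l). \<eta> k x = \<eta> l y \<and> z = \<theta> l y) = \<theta> k x"
      using that wd by (intro the_equality) (blast, metis)
    ultimately show ?thesis by (simp add: h_def)
  qed
  have "h \<in> hom G H"
  proof (rule homI)
    fix g assume "g \<in> carrier G"
    then show "h g \<in> carrier H" using surj h hom_in_carrier[OF \<theta>] by auto
  next
    fix g g' assume g: "g \<in> carrier G" "g' \<in> carrier G"
    obtain k x l y where "x \<in> carrier (Gr k)" "g = \<eta> k x" "y \<in> carrier (Gr l)" "g' = \<eta> l y"
      using g surj by auto
    then obtain m u v where m: "u \<in> carrier (Gr m)" "v \<in> carrier (Gr m)" "g = \<eta> m u" "g' = \<eta> m v"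
      using common by metis
    have uv: "u \<otimes>\<^bsub>Gr m\<^esub> v \<in> carrier (Gr m)"
      using m grp[of m] by (simp add: group.is_monoid monoid.m_closed)
    show "h (g \<otimes>\<^bsub>G\<^esub> g') = h g \<otimes>\<^bsub>H\<^esub> h g'"
      using m h[OF uv] hom_mult[OF \<eta>[of m] m(1,2)] hom_mult[OF \<theta>[of m] m(1,2)] by (simp add: h)
  qed
  then have ex: "h \<in> hom G H \<inter> extensional (carrier G)" by (simp add: h_def)
  show ?thesis
  proof (rule ex1I[of _ h])
    fix f assume f: "f \<in> hom G H \<inter> extensional (carrier G) \<and>
           (\<forall>k. \<forall>x\<in>carrier (Gr k). f (\<eta> k x) = \<theta> k x)"
    show "f = h"
      using f ex by (intro extensionalityI[of _ "carrier G"]) (auto simp: surj h)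
  qed (use ex h in auto)
qed

definition injectivity_radius ::
    "('a, 'm) monoid_scheme \<Rightarrow> 'a set \<Rightarrow> ('a \<Rightarrow> 'b) \<Rightarrow> enat" where
  "injectivity_radius G S f =
     Sup {enat R | R. \<forall>g\<in>carrier G. inj_on f (word_ball G S g R)}"


section \<open>The approximating sequence\<close>

locale lacunary_hyperbolic =
  fixes G :: "('b, 'n) monoid_scheme" and S :: "'b set"
    and Gr :: "nat \<Rightarrow> ('a, 'm) monoid_scheme" and Sr :: "nat \<Rightarrow> 'a set"
    and \<alpha> :: "nat \<Rightarrow> 'a \<Rightarrow> 'a" and \<eta> :: "nat \<Rightarrow> 'a \<Rightarrow> 'b" and \<delta> :: "nat \<Rightarrow> real"
  assumes group_G: "group G"
    and group_Gr: "group (Gr k)"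
    and generating_G: "finite_generating_set G S"
    and generating_Gr: "finite_generating_set (Gr k) (Sr k)"
    and \<alpha>_epi: "\<alpha> k \<in> epi (Gr k) (Gr (Suc k))"
    and \<alpha>_generators: "\<alpha> k ` Sr k = Sr (Suc k)"
    and direct_limit: "is_direct_limit Gr \<alpha> G \<eta>"
    and \<eta>_generators: "\<eta> k ` Sr k = S"
    and \<delta>_pos: "\<delta> k > 0"
    and hyperbolic:
      "hyperbolic_space (\<delta> k) (cayley_graph (Gr k) (Sr k)) (cayley_dist (Gr k) (Sr k))"
    and injectivity:
      "((\<lambda>k. ereal_of_enat (injectivity_radius (Gr k) (Sr k) (\<eta> k)) / ereal (\<delta> k)) \<longlongrightarrow> \<infinity>) sequentially"
    and free: "free_group_with_basis (Gr 0) (Sr 0)"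


section \<open>Endomorphisms and coherent lifts\<close>

text \<open>Endomorphisms are taken to be extensional, so that equality of maps is equality on the carrier.\<close>

definition Mor :: "('b, 'n) monoid_scheme \<Rightarrow> ('b \<Rightarrow> 'b) set" where
  "Mor G = hom G G \<inter> extensional (carrier G)"

definition inner_aut :: "('b, 'n) monoid_scheme \<Rightarrow> 'b \<Rightarrow> 'b \<Rightarrow> 'b" where
  "inner_aut G g = (\<lambda>x\<in>carrier G. g \<otimes>\<^bsub>G\<^esub> x \<otimes>\<^bsub>G\<^esub> inv\<^bsub>G\<^esub> g)"

definition inner_rel :: "('b, 'n) monoid_scheme \<Rightarrow> (('b \<Rightarrow> 'b) \<times> ('b \<Rightarrow> 'b)) set" where
  "inner_rel G = {(\<phi>\<^sub>1, \<phi>\<^sub>2). \<phi>\<^sub>1 \<in> Mor G \<and> \<phi>\<^sub>2 \<in> Mor G \<and>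
     (\<exists>g\<in>carrier G. \<phi>\<^sub>1 = compose (carrier G) (inner_aut G g) \<phi>\<^sub>2)}"

definition OMor :: "('b, 'n) monoid_scheme \<Rightarrow> ('b \<Rightarrow> 'b) set set" where
  "OMor G = Mor G // inner_rel G"

text \<open>Here \<open>transition \<alpha> 0 k\<close> is the natural epimorphism $\pi_k$ from $G_0$ to $G_k$.\<close>

definition coherently_lifts ::
    "(nat \<Rightarrow> ('a, 'm) monoid_scheme) \<Rightarrow> (nat \<Rightarrow> 'a \<Rightarrow> 'a) \<Rightarrow> (nat \<Rightarrow> 'a \<Rightarrow> 'b) \<Rightarrow>
     nat \<Rightarrow> ('b \<Rightarrow> 'b) \<Rightarrow> bool" where
  "coherently_lifts Gr \<alpha> \<eta> n \<phi> \<longleftrightarrow>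
     (\<exists>\<phi>\<^sub>0\<in>hom (Gr 0) (Gr 0).
        (\<forall>x\<in>carrier (Gr 0). \<eta> 0 (\<phi>\<^sub>0 x) = \<phi> (\<eta> 0 x)) \<and>
        (\<forall>k\<ge>n. \<exists>\<psi>\<in>hom (Gr k) (Gr k).
           \<forall>x\<in>carrier (Gr 0). \<psi> (transition \<alpha> 0 k x) = transition \<alpha> 0 k (\<phi>\<^sub>0 x)))"

definition Mor_step ::
    "('b, 'n) monoid_scheme \<Rightarrow> (nat \<Rightarrow> ('a, 'm) monoid_scheme) \<Rightarrow> (nat \<Rightarrow> 'a \<Rightarrow> 'a) \<Rightarrow>
     (nat \<Rightarrow> 'a \<Rightarrow> 'b) \<Rightarrow> nat \<Rightarrow> ('b \<Rightarrow> 'b) set" where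
  "Mor_step G Gr \<alpha> \<eta> n = {\<phi> \<in> Mor G. coherently_lifts Gr \<alpha> \<eta> n \<phi>}"

definition OMor_step ::
    "('b, 'n) monoid_scheme \<Rightarrow> (nat \<Rightarrow> ('a, 'm) monoid_scheme) \<Rightarrow> (nat \<Rightarrow> 'a \<Rightarrow> 'a) \<Rightarrow>
     (nat \<Rightarrow> 'a \<Rightarrow> 'b) \<Rightarrow> nat \<Rightarrow> ('b \<Rightarrow> 'b) set set" where
  "OMor_step G Gr \<alpha> \<eta> n = (\<lambda>\<phi>. inner_rel G `` {\<phi>}) ` Mor_step G Gr \<alpha> \<eta> n"

lemma equiv_inner_rel:
  fixes G (structure)
  assumes "group G"
  shows "equiv (Mor G) (inner_rel G)"
proof -
  interpret group G by fact
  have eq: "compose (carrier G) (inner_aut G g) \<phi> = (\<lambda>x\<in>carrier G. g \<otimes>\<^bsub>G\<^esub> \<phi> x \<otimes>\<^bsub>G\<^esub> inv\<^bsub>G\<^esub> g)"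
    if "\<phi> \<in> Mor G" "g \<in> carrier G" for g \<phi>
    using that by (auto simp: compose_def inner_aut_def Mor_def fun_eq_iff dest: hom_in_carrier)
  have clo: "\<phi> x \<in> carrier G" if "\<phi> \<in> Mor G" "x \<in> carrier G" for \<phi> x
    using that by (auto simp: Mor_def dest: hom_in_carrier)
  have ext: "\<phi> x = undefined" if "\<phi> \<in> Mor G" "x \<notin> carrier G" for \<phi> x
    using that by (auto simp: Mor_def extensional_def)
  show ?thesis
  proof (rule equivI)
    show "inner_rel G \<subseteq> Mor G \<times> Mor G" by (auto simp: inner_rel_def)
    show "refl_on (Mor G) (inner_rel G)"
    proof (rule refl_onI)
      fix \<phi> assume \<phi>: "\<phi> \<in> Mor G"
      have "\<phi> = compose (carrier G) (inner_aut G \<one>) \<phi>"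
        using ext[OF \<phi>] clo[OF \<phi>] by (auto simp: eq[OF \<phi>] fun_eq_iff restrict_def)
      then show "(\<phi>, \<phi>) \<in> inner_rel G" using \<phi> by (auto simp: inner_rel_def)
    qed
    show "sym (inner_rel G)"
    proof (rule symI)
      fix \<phi> \<psi> assume "(\<phi>, \<psi>) \<in> inner_rel G"
      then obtain g where g: "g \<in> carrier G" "\<phi> \<in> Mor G" "\<psi> \<in> Mor G"
        "\<phi> = compose (carrier G) (inner_aut G g) \<psi>" by (auto simp: inner_rel_def)
      have "\<psi> x = inv g \<otimes> \<phi> x \<otimes> inv (inv g)" if "x \<in> carrier G" for x
        using g(1) clo[OF g(3) that] that unfolding g(4) eq[OF g(3,1)]
        by (simp add: m_assoc) (simp add: m_assoc[symmetric])
      then have "\<psi> = compose (carrier G) (inner_aut G (inv g)) \<phi>"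
        using ext[OF g(3)] g(1) by (auto simp: eq[OF g(2)] fun_eq_iff restrict_def)
      then show "(\<psi>, \<phi>) \<in> inner_rel G" using g inv_closed by (auto simp: inner_rel_def)
    qed
    show "trans (inner_rel G)"
    proof (rule transI)
      fix \<phi> \<psi> \<chi> assume "(\<phi>, \<psi>) \<in> inner_rel G" "(\<psi>, \<chi>) \<in> inner_rel G"
      then obtain g h where g: "g \<in> carrier G" "h \<in> carrier G" "\<phi> \<in> Mor G" "\<psi> \<in> Mor G" "\<chi> \<in> Mor G"
        "\<phi> = compose (carrier G) (inner_aut G g) \<psi>" "\<psi> = compose (carrier G) (inner_aut G h) \<chi>"
        by (auto simp: inner_rel_def)
      have "\<phi> = compose (carrier G) (inner_aut G (g \<otimes> h)) \<chi>"
        unfolding g(6) eq[OF g(4,1)] unfolding g(7) using g(1,2) clo[OF g(5)]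
        by (auto simp: eq[OF g(5)] fun_eq_iff restrict_def m_assoc inv_mult_group)
      then show "(\<phi>, \<chi>) \<in> inner_rel G" using g(1-3,5) m_closed by (auto simp: inner_rel_def)
    qed
  qed
qed

end

theory Submission
  imports Defs
begin

text \<open>
  The proof rests on one fact about a group $\Gamma$ whose Cayley graph is $\delta$-hyperbolic: all
  its relations are consequences of relations of length at most $4\delta + 6$.  This is
  \<open>bounded_relators\<close>.  It follows from thinness of the triangles with vertices $1$, $g$ and $g'$,
  where $g$ and $g'$ are adjacent: two geodesics from $1$ to $g$ and to $g'$ stay within
  $2\delta + 2$ of each other at equal times (\<open>fellow_travel\<close>), so the triangle is filled by a
  ladder of short loops.  A loop of arbitrary length is filled by the triangles over its edges.

  Let $\phi$ be an endomorphism of $G$.  Since $G_0$ is free and $\eta_0$ is onto, $\phi$ lifts to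
  an endomorphism $\phi_0$ of $G_0$ (\<open>ex_free_lift\<close>).  This $\phi_0$ induces an endomorphism of
  $G_k$ as soon as $\phi_0$ sends the relations of $G_k$ of length at most $4\delta_k + 6$ to
  relations of $G_k$.  Such a relation holds in $G$ too, so its image under $\phi_0$ is trivial in
  $G$, and the question is whether this image is already trivial in $G_k$.

  If $\delta_k > 1$, the image has length at most $10 L \delta_k$, where $L$ bounds the length of
  $\phi_0$ on the basis; for large $k$ this is less than the injectivity radius of $\eta_k$
  (\<open>eventually_injective_linear\<close>).  If $\delta_k \le 1$, the ratio of the injectivity radius to
  $\delta_k$ does not control the injectivity radius itself, but then the relations in question
  have length at most $10$.  There are finitely many words of this length, and an element that dies
  in the direct limit dies in $G_k$ for all large $k$ (\<open>eventually_trivial\<close>).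
\<close>

section \<open>Words and word length\<close>

definition word_inverse :: "'a word \<Rightarrow> 'a word" where
  "word_inverse w = map (\<lambda>(b, x). (\<not> b, x)) (rev w)"

lemma words_Nil [simp]: "[] \<in> words S"
  by (simp add: words_def)

lemma words_Cons [simp]: "(b, x) # w \<in> words S \<longleftrightarrow> x \<in> S \<and> w \<in> words S"
  by (auto simp: words_def)

lemma words_append [simp]: "v @ w \<in> words S \<longleftrightarrow> v \<in> words S \<and> w \<in> words S"
  by (auto simp: words_def)

lemma words_take: "w \<in> words S \<Longrightarrow> take i w \<in> words S"
  by (metis append_take_drop_id words_append)

lemma words_drop: "w \<in> words S \<Longrightarrow> drop i w \<in> words S"
  by (metis append_take_drop_id words_append)

lemma words_inverse: "w \<in> words S \<Longrightarrow> word_inverse w \<in> words S"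
  by (auto simp: words_def word_inverse_def)

lemma words_map: "w \<in> words S \<Longrightarrow> f ` S \<subseteq> T \<Longrightarrow> map (apsnd f) w \<in> words T"
  by (induction w) (auto simp: image_subset_iff)

lemma words_lift:
  assumes "w \<in> words (f ` T)"
  shows "\<exists>v\<in>words T. map (apsnd f) v = w"
  using assms
proof (induction w)
  case (Cons a w)
  obtain b y where a: "a = (b, y)" by force
  then obtain x v where "x \<in> T" "y = f x" "v \<in> words T" "map (apsnd f) v = w"
    using Cons by auto
  then show ?case using a by (intro bexI[of _ "(b, x) # v"]) auto
qed (auto intro!: bexI[of _ "[]"])

lemma finite_words_length:
  assumes "finite S"
  shows "finite {w \<in> words S. length w \<le> n}"
proof -
  have "{w \<in> words S. length w \<le> n} \<subseteq> {w. set w \<subseteq> UNIV \<times> S \<and> length w \<le> n}"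
    by (auto simp: words_def image_subset_iff mem_Times_iff)
  moreover have "finite {w. set w \<subseteq> (UNIV :: bool set) \<times> S \<and> length w \<le> n}"
    using assms by (intro finite_lists_length_le) auto
  ultimately show ?thesis by (rule finite_subset)
qed

lemma word_eval_Nil [simp]: "word_eval G [] = \<one>\<^bsub>G\<^esub>"
  by (simp add: word_eval_def)

lemma word_eval_Cons [simp]:
  "word_eval G ((b, x) # w) = (if b then x else inv\<^bsub>G\<^esub> x) \<otimes>\<^bsub>G\<^esub> word_eval G w"
  by (simp add: word_eval_def)

context group
begin

lemma word_eval_closed [simp]:
  "w \<in> words S \<Longrightarrow> S \<subseteq> carrier G \<Longrightarrow> word_eval G w \<in> carrier G"
  by (induction w) auto

lemma word_eval_append:
  assumes "S \<subseteq> carrier G" "v \<in> words S" "w \<in> words S"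
  shows "word_eval G (v @ w) = word_eval G v \<otimes> word_eval G w"
  using assms(2)
proof (induction v)
  case (Cons a v)
  then show ?case using assms(1,3) by (cases a) (auto simp: m_assoc subset_iff)
qed (use assms in auto)

lemma word_eval_inverse:
  assumes "S \<subseteq> carrier G" "w \<in> words S"
  shows "word_eval G (word_inverse w) = inv (word_eval G w)"
  using assms(2)
proof (induction w)
  case (Cons a w)
  obtain b x where a: "a = (b, x)" by force
  have "word_eval G (word_inverse w @ [(\<not> b, x)])
      = word_eval G (word_inverse w) \<otimes> word_eval G [(\<not> b, x)]"
    using Cons a words_inverse[of w S] by (intro word_eval_append[OF assms(1)]) auto
  moreover have "x \<in> carrier G" "word_eval G w \<in> carrier G"
    using Cons.prems a assms(1) by auto
  ultimately show ?case using Cons a by (simp add: word_inverse_def inv_mult_group)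
qed (simp add: word_inverse_def)

lemma hom_word_eval:
  assumes "group H" "h \<in> hom G H" "S \<subseteq> carrier G" "w \<in> words S"
  shows "h (word_eval G w) = word_eval H (map (apsnd h) w)"
proof -
  interpret H: group_hom G H h
    using assms by (simp add: group_hom_def group_hom_axioms_def is_group)
  show ?thesis using assms(4)
  proof (induction w)
    case (Cons a w)
    then show ?case using assms(3) by (cases a) (auto simp: subset_iff)
  qed auto
qed

end

locale generated_group = group G for G (structure) +
  fixes S
  assumes finite_generating_set: "finite_generating_set G S"
begin

lemma generators_subset: "S \<subseteq> carrier G"
  using finite_generating_set by (simp add: finite_generating_set_def)

lemma generators_finite: "finite S"
  using finite_generating_set by (simp add: finite_generating_set_def)

lemmas eval_closed [simp] = word_eval_closed[OF _ generators_subset]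
lemmas eval_append = word_eval_append[OF generators_subset]

lemma ex_word:
  assumes "g \<in> carrier G"
  shows "\<exists>w\<in>words S. word_eval G w = g"
proof -
  have "g \<in> generate G S"
    using assms finite_generating_set by (simp add: finite_generating_set_def)
  then show ?thesis
  proof (induction rule: generate.induct)
    case one
    then show ?case by (intro bexI[of _ "[]"]) auto
  next
    case (incl h)
    then show ?case using generators_subset by (intro bexI[of _ "[(True, h)]"]) auto
  next
    case (inv h)
    then show ?case using generators_subset by (intro bexI[of _ "[(False, h)]"]) auto
  next
    case (eng h1 h2)
    then show ?case using eval_append by (metis words_append)
  qed
qed

lemma ex_shortest_word:
  assumes "g \<in> carrier G"
  obtains w where "w \<in> words S" "length w = word_length G S g" "word_eval G w = g"
proof -
  have "\<exists>n. \<exists>w\<in>words S. length w = n \<and> word_eval G w = g"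
    using ex_word[OF assms] by auto
  from LeastI_ex[OF this] show ?thesis using that unfolding word_length_def by blast
qed

lemma word_length_eval_le: "w \<in> words S \<Longrightarrow> word_length G S (word_eval G w) \<le> length w"
  unfolding word_length_def by (rule Least_le) auto

lemma word_length_one [simp]: "word_length G S \<one> = 0"
  using word_length_eval_le[of "[]"] by simp

lemma word_length_mult:
  assumes "g \<in> carrier G" "h \<in> carrier G"
  shows "word_length G S (g \<otimes> h) \<le> word_length G S g + word_length G S h"
proof -
  obtain v w where "v \<in> words S" "length v = word_length G S g" "word_eval G v = g"
    "w \<in> words S" "length w = word_length G S h" "word_eval G w = h"
    using assms ex_shortest_word by metis
  then show ?thesis using word_length_eval_le[of "v @ w"] by (simp add: eval_append)
qed

lemma word_length_inv_le:
  assumes "g \<in> carrier G"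
  shows "word_length G S (inv g) \<le> word_length G S g"
proof -
  obtain v where "v \<in> words S" "length v = word_length G S g" "word_eval G v = g"
    using assms ex_shortest_word by metis
  then show ?thesis
    using word_length_eval_le[OF words_inverse[of v S]] word_eval_inverse[OF generators_subset]
    by (simp add: word_inverse_def)
qed

lemma word_length_inv [simp]: "g \<in> carrier G \<Longrightarrow> word_length G S (inv g) = word_length G S g"
  using word_length_inv_le[of g] word_length_inv_le[of "inv g"] by simp

lemma word_length_eq_0: "g \<in> carrier G \<Longrightarrow> word_length G S g = 0 \<Longrightarrow> g = \<one>"
  by (metis ex_shortest_word length_0_conv word_eval_Nil)

lemma word_eval_take_Suc:
  assumes "w \<in> words S"
  shows "\<exists>l\<in>carrier G. word_length G S l \<le> 1 \<and>
    word_eval G (take (Suc i) w) = word_eval G (take i w) \<otimes> l"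
proof (intro bexI conjI)
  have l: "take 1 (drop i w) \<in> words S" using assms words_take words_drop by metis
  then show "word_eval G (take 1 (drop i w)) \<in> carrier G" by simp
  show "word_length G S (word_eval G (take 1 (drop i w))) \<le> 1"
    using word_length_eval_le[OF l] by simp
  show "word_eval G (take (Suc i) w) = word_eval G (take i w) \<otimes> word_eval G (take 1 (drop i w))"
    using take_add[of i 1 w] eval_append[OF words_take[OF assms, of i] l] by simp
qed

lemma finite_word_length_le: "finite {g \<in> carrier G. word_length G S g \<le> n}"
proof (rule finite_subset)
  show "{g \<in> carrier G. word_length G S g \<le> n} \<subseteq> word_eval G ` {w \<in> words S. length w \<le> n}"
  proof
    fix g assume "g \<in> {g \<in> carrier G. word_length G S g \<le> n}"
    then have g: "g \<in> carrier G" "word_length G S g \<le> n" by auto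
    from ex_shortest_word[OF g(1)] obtain w
      where "w \<in> words S" "length w = word_length G S g" "word_eval G w = g" .
    then show "g \<in> word_eval G ` {w \<in> words S. length w \<le> n}" using g(2) by auto
  qed
qed (use finite_words_length generators_finite in auto)

lemma word_dist_one_left [simp]: "g \<in> carrier G \<Longrightarrow> word_dist G S \<one> g = word_length G S g"
  by (simp add: word_dist_def)

lemma word_dist_sym:
  assumes "g \<in> carrier G" "h \<in> carrier G"
  shows "word_dist G S g h = word_dist G S h g"
proof -
  have "inv (inv g \<otimes> h) = inv h \<otimes> g" using assms by (simp add: inv_mult_group)
  then show ?thesis
    using assms word_length_inv[of "inv g \<otimes> h"] by (simp add: word_dist_def)
qed

lemma word_dist_triangle:
  assumes "g \<in> carrier G" "h \<in> carrier G" "k \<in> carrier G"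
  shows "word_dist G S g k \<le> word_dist G S g h + word_dist G S h k"
proof -
  have "inv g \<otimes> k = (inv g \<otimes> h) \<otimes> (inv h \<otimes> k)"
    using assms by (metis inv_closed inv_solve_left m_assoc m_closed)
  then show ?thesis
    using assms word_length_mult[of "inv g \<otimes> h" "inv h \<otimes> k"] by (simp add: word_dist_def)
qed

lemma word_dist_eq_0 [simp]:
  assumes "g \<in> carrier G" "h \<in> carrier G"
  shows "word_dist G S g h = 0 \<longleftrightarrow> g = h"
proof
  assume "word_dist G S g h = 0"
  then have "inv g \<otimes> h = \<one>" using assms word_length_eq_0 by (simp add: word_dist_def)
  then show "g = h" using assms by (metis inv_closed inv_equality inv_inv)
qed (use assms in \<open>simp add: word_dist_def\<close>)

end

lemma (in generated_group) word_dist_self [simp]: "g \<in> carrier G \<Longrightarrow> word_dist G S g g = 0"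
  by simp

lemma word_length_hom_le:
  assumes E: "generated_group E T" and H: "generated_group H U" and h: "h \<in> hom E H"
    and bound: "\<And>t. t \<in> T \<Longrightarrow> word_length H U (h t) \<le> L"
    and e: "e \<in> carrier E"
  shows "word_length H U (h e) \<le> L * word_length E T e"
proof -
  interpret E: generated_group E T by fact
  interpret H: generated_group H U by fact
  interpret h: group_hom E H h
    using h by (simp add: group_hom_def group_hom_axioms_def E.is_group H.is_group)
  obtain w where w: "w \<in> words T" "length w = word_length E T e" "word_eval E w = e"
    using E.ex_shortest_word[OF e] by blast
  have "word_length H U (h (word_eval E w)) \<le> L * length w"
    using w(1)
  proof (induction w)
    case (Cons a w)
    obtain b t where a: "a = (b, t)" by force
    have t: "t \<in> T" "t \<in> carrier E" and w: "w \<in> words T"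
      using Cons.prems a E.generators_subset by auto
    have "word_length H U (h (if b then t else inv\<^bsub>E\<^esub> t)) \<le> L"
      using t bound[OF t(1)] by auto
    then show ?case
      using H.word_length_mult[of "h (if b then t else inv\<^bsub>E\<^esub> t)" "h (word_eval E w)"] t w
        Cons.IH[OF w] a by simp
  qed simp
  then show ?thesis using w by simp
qed

lemma word_length_image_le:
  assumes E: "generated_group E T" and G: "generated_group G S" and p: "p \<in> hom E G" "p ` T = S"
    and e: "e \<in> carrier E"
  shows "word_length G S (p e) \<le> word_length E T e"
proof -
  interpret E: generated_group E T by fact
  interpret G: generated_group G S by fact
  have "word_length G S (p t) \<le> 1" if "t \<in> T" for t
  proof -
    have "[(True, p t)] \<in> words S" "p t \<in> carrier G" using p(2) that G.generators_subset by auto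
    then show ?thesis using G.word_length_eval_le[of "[(True, p t)]"] by simp
  qed
  from word_length_hom_le[OF E G p(1) this e] show ?thesis by simp
qed

section \<open>Thin triangles of vertices\<close>

context generated_group
begin

definition vertex_geodesic :: "(nat \<Rightarrow> 'a) \<Rightarrow> nat \<Rightarrow> bool" where
  "vertex_geodesic x n \<longleftrightarrow> (\<forall>i\<le>n. x i \<in> carrier G) \<and>
     (\<forall>i\<le>n. \<forall>j\<le>n. real (word_dist G S (x i) (x j)) = \<bar>real i - real j\<bar>)"

text \<open>The point at time $t$ of the path that runs through \<open>x 0, \<dots>, x n\<close> at unit speed.
  Its barycentric coordinate at \<open>x i\<close> is the tent function centred at time $i$.  Written in
  this way, the formula needs no choice of the edge that contains the point.\<close>

definition geodesic_point :: "(nat \<Rightarrow> 'a) \<Rightarrow> nat \<Rightarrow> real \<Rightarrow> 'a \<Rightarrow> real" where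
  "geodesic_point x n t v = (\<Sum>i | i \<le> n \<and> x i = v. max 0 (1 - \<bar>t - real i\<bar>))"

lemma vertex_geodesic_inj:
  assumes "vertex_geodesic x n" "i \<le> n" "j \<le> n"
  shows "x i = x j \<longleftrightarrow> i = j"
proof
  assume "x i = x j"
  moreover have "real (word_dist G S (x i) (x j)) = \<bar>real i - real j\<bar>" "x j \<in> carrier G"
    using assms by (auto simp: vertex_geodesic_def)
  ultimately show "i = j" by (simp add: word_dist_def)
qed simp

lemma geodesic_point_vertex:
  assumes "vertex_geodesic x n" "i \<le> n"
  shows "geodesic_point x n t (x i) = max 0 (1 - \<bar>t - real i\<bar>)"
proof -
  have "{j. j \<le> n \<and> x j = x i} = {i}" using assms vertex_geodesic_inj by auto
  then show ?thesis by (simp add: geodesic_point_def)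
qed

lemma support_geodesic_point:
  assumes "vertex_geodesic x n"
  shows "support (geodesic_point x n t) = x ` {i. i \<le> n \<and> \<bar>t - real i\<bar> < 1}"
proof (intro Set.set_eqI iffI)
  fix v assume v: "v \<in> support (geodesic_point x n t)"
  have "\<exists>i\<le>n. x i = v"
  proof (rule ccontr)
    assume "\<not> (\<exists>i\<le>n. x i = v)"
    then have none: "{i. i \<le> n \<and> x i = v} = {}" by auto
    have "geodesic_point x n t v = 0" unfolding geodesic_point_def none by simp
    then show False using v by (simp add: support_def)
  qed
  then show "v \<in> x ` {i. i \<le> n \<and> \<bar>t - real i\<bar> < 1}"
    using v geodesic_point_vertex[OF assms] by (auto simp: support_def max_def split: if_splits)
qed (use geodesic_point_vertex[OF assms] in \<open>auto simp: support_def\<close>)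

text \<open>The adjacency may be witnessed by the inverse of a generator; the edge is then a cell with
  the roles of its end points exchanged.\<close>

lemma cell_of_adjacent:
  assumes "g \<in> carrier G" "h \<in> carrier G" "word_dist G S g h = 1"
  shows "{g, h} \<in> cayley_cells G S"
proof -
  obtain w where w: "w \<in> words S" "length w = 1" "word_eval G w = inv g \<otimes> h"
    using ex_shortest_word[of "inv g \<otimes> h"] assms by (auto simp: word_dist_def)
  then obtain b s where "w = [(b, s)]" by (metis One_nat_def length_0_conv length_Suc_conv surj_pair)
  then have s: "s \<in> S" "s \<in> carrier G" "(if b then s else inv s) = inv g \<otimes> h"
    using w generators_subset by auto
  have h: "h = g \<otimes> (inv g \<otimes> h)" using assms by (simp add: m_assoc[symmetric])
  show ?thesis
  proof (cases b)
    case True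
    then have "h = g \<otimes> s" using s h by simp
    then show ?thesis using s(1) assms(1) by (auto simp: cayley_cells_def)
  next
    case False
    then have "h = g \<otimes> inv s" using s h by simp
    then have "g = h \<otimes> s" using s assms by (simp add: m_assoc)
    then have "{h, h \<otimes> s} = {g, h}" by auto
    then show ?thesis using s(1) assms(2) unfolding cayley_cells_def by blast
  qed
qed

lemma indices_near:
  assumes "0 \<le> t" "t \<le> real n"
  shows "{i. i \<le> n \<and> \<bar>t - real i\<bar> < 1} = {nat \<lfloor>t\<rfloor>, nat \<lceil>t\<rceil>}"
proof (intro Set.set_eqI)
  fix i
  show "i \<in> {i. i \<le> n \<and> \<bar>t - real i\<bar> < 1} \<longleftrightarrow> i \<in> {nat \<lfloor>t\<rfloor>, nat \<lceil>t\<rceil>}"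
    using assms by (simp add: abs_less_iff) linarith
qed

lemma geodesic_point_in_cayley_graph:
  assumes x: "vertex_geodesic x n" and t: "0 \<le> t" "t \<le> real n"
  shows "geodesic_point x n t \<in> cayley_graph G S"
proof -
  let ?a = "nat \<lfloor>t\<rfloor>" and ?b = "nat \<lceil>t\<rceil>"
  have supp: "support (geodesic_point x n t) = {x ?a, x ?b}"
    using support_geodesic_point[OF x, of t] indices_near[OF t] by auto
  have ab: "?a \<le> n" "?b \<le> n" using t by linarith+
  have c: "x ?a \<in> carrier G" "x ?b \<in> carrier G" using ab x by (auto simp: vertex_geodesic_def)
  have pa: "geodesic_point x n t (x ?a) = 1 - \<bar>t - real ?a\<bar>"
    and pb: "geodesic_point x n t (x ?b) = 1 - \<bar>t - real ?b\<bar>"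
    using geodesic_point_vertex[OF x] ab t by (simp; linarith)+
  have "support (geodesic_point x n t) \<in> cayley_cells G S \<and>
    sum (geodesic_point x n t) (support (geodesic_point x n t)) = 1"
  proof (cases "?a = ?b")
    case True
    then have "t = real ?a" using t by linarith
    then show ?thesis using c pa True unfolding supp by (auto simp: cayley_cells_def)
  next
    case False
    then have b: "?b = ?a + 1" using t by linarith
    have "real (word_dist G S (x ?a) (x ?b)) = \<bar>real ?a - real ?b\<bar>"
      using x ab by (auto simp: vertex_geodesic_def)
    then have "word_dist G S (x ?a) (x ?b) = 1" using b by simp
    moreover have "x ?a \<noteq> x ?b" using vertex_geodesic_inj[OF x ab] False by simp
    moreover have "geodesic_point x n t (x ?a) + geodesic_point x n t (x ?b) = 1"
      unfolding pa pb using b t by linarith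
    ultimately show ?thesis
      using cell_of_adjacent[OF c] unfolding supp by simp
  qed
  moreover have "geodesic_point x n t v \<ge> 0" for v
    by (auto simp: geodesic_point_def intro: sum_nonneg)
  ultimately show ?thesis by (simp add: cayley_graph_def)
qed

text \<open>If the two points do not share their open cell, the distance is a minimum of expressions
  $|s - i| + |i - j| + |t - j|$.  Each of them is at least $|s - t|$ by the triangle inequality
  on the real line, and equality holds for the vertices next to $s$ and $t$ that lie between
  $s$ and $t$.  Inside one open cell all coordinates change at unit speed.\<close>

lemma cayley_dist_geodesic_points:
  assumes x: "vertex_geodesic x n" and s: "0 \<le> s" "s \<le> real n" and t: "0 \<le> t" "t \<le> real n"
  shows "cayley_dist G S (geodesic_point x n s) (geodesic_point x n t) = \<bar>s - t\<bar>"
proof -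
  let ?I = "\<lambda>t. {i. i \<le> n \<and> \<bar>t - real i\<bar> < 1}"
  let ?p = "geodesic_point x n"
  note supp = support_geodesic_point[OF x]
  have I: "?I s = {nat \<lfloor>s\<rfloor>, nat \<lceil>s\<rceil>}" "?I t = {nat \<lfloor>t\<rfloor>, nat \<lceil>t\<rceil>}"
    using indices_near s t by auto
  have val: "?p r (x i) = 1 - \<bar>r - real i\<bar>" if "i \<in> ?I r" for r i
    using that geodesic_point_vertex[OF x] by auto
  have inj: "inj_on x {..n}" using vertex_geodesic_inj[OF x] by (auto intro: inj_onI)
  show ?thesis
  proof (cases "support (?p s) = support (?p t)")
    case True
    then have "?I s = ?I t"
      unfolding supp using inj by (subst (asm) inj_on_image_eq_iff[of _ "{..n}"]) auto
    then have eq: "{nat \<lfloor>s\<rfloor>, nat \<lceil>s\<rceil>} = {nat \<lfloor>t\<rfloor>, nat \<lceil>t\<rceil>}" using I by simp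
    have fl: "nat \<lfloor>s\<rfloor> \<le> nat \<lceil>s\<rceil>" "nat \<lfloor>t\<rfloor> \<le> nat \<lceil>t\<rceil>" by linarith+
    then have ab: "nat \<lfloor>s\<rfloor> = nat \<lfloor>t\<rfloor>" "nat \<lceil>s\<rceil> = nat \<lceil>t\<rceil>"
      using eq by (metis doubleton_eq_iff order_antisym)+
    have "\<bar>?p s v - ?p t v\<bar> = \<bar>s - t\<bar>" if v: "v \<in> support (?p s)" for v
    proof -
      obtain i where i: "i \<in> ?I s" "v = x i" using v supp by auto
      then have "i \<in> ?I t" "i = nat \<lfloor>s\<rfloor> \<or> i = nat \<lceil>s\<rceil>" using \<open>?I s = ?I t\<close> I by blast+
      moreover have "real (nat \<lfloor>s\<rfloor>) \<le> s" "real (nat \<lfloor>s\<rfloor>) \<le> t" "s \<le> real (nat \<lceil>s\<rceil>)"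
        "t \<le> real (nat \<lceil>s\<rceil>)" using s t ab by linarith+
      ultimately show ?thesis using val[OF i(1)] val[of i t] i(2) by auto
    qed
    then have "(\<lambda>v. \<bar>?p s v - ?p t v\<bar>) ` support (?p s) = (\<lambda>v. \<bar>s - t\<bar>) ` support (?p s)"
      by (intro image_cong) auto
    moreover have "support (?p s) \<noteq> {}" using supp I by auto
    ultimately show ?thesis using True by (simp add: cayley_dist_def image_constant_conv)
  next
    case False
    let ?D = "{(1 - ?p s u) + real (word_dist G S u v) + (1 - ?p t v) | u v.
                 u \<in> support (?p s) \<and> v \<in> support (?p t)}"
    have D: "?D = (\<lambda>(i, j). \<bar>s - real i\<bar> + \<bar>real i - real j\<bar> + \<bar>t - real j\<bar>) ` (?I s \<times> ?I t)"
    proof -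
      have "?D = (\<lambda>(i, j). (1 - ?p s (x i)) + real (word_dist G S (x i) (x j)) + (1 - ?p t (x j)))
        ` (?I s \<times> ?I t)" unfolding supp by (auto simp: image_iff)
      also have "\<dots> = (\<lambda>(i, j). \<bar>s - real i\<bar> + \<bar>real i - real j\<bar> + \<bar>t - real j\<bar>) ` (?I s \<times> ?I t)"
        using x by (intro image_cong) (auto simp: val vertex_geodesic_def)
      finally show ?thesis .
    qed
    have "Min ?D = \<bar>s - t\<bar>"
    proof (rule Min_eqI)
      show "finite ?D" unfolding D using I by simp
      show "\<bar>s - t\<bar> \<le> y" if "y \<in> ?D" for y using that unfolding D by auto
      have ne: "?I s \<noteq> ?I t" using False unfolding supp by metis
      show "\<bar>s - t\<bar> \<in> ?D"
      proof (cases "s \<le> t")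
        case True
        have "nat \<lceil>s\<rceil> \<le> nat \<lfloor>t\<rfloor>"
        proof (rule ccontr)
          assume "\<not> nat \<lceil>s\<rceil> \<le> nat \<lfloor>t\<rfloor>"
          then have "\<lfloor>s\<rfloor> = \<lfloor>t\<rfloor>" "\<lceil>s\<rceil> = \<lceil>t\<rceil>" using True s t by linarith+
          then show False using ne I by simp
        qed
        then have "real (nat \<lceil>s\<rceil>) \<le> real (nat \<lfloor>t\<rfloor>)" by (rule of_nat_mono)
        moreover have "s \<le> real (nat \<lceil>s\<rceil>)" "real (nat \<lfloor>t\<rfloor>) \<le> t"
          using s t real_nat_ceiling_ge of_nat_floor by auto
        ultimately have "\<bar>s - t\<bar> = \<bar>s - real (nat \<lceil>s\<rceil>)\<bar> + \<bar>real (nat \<lceil>s\<rceil>) - real (nat \<lfloor>t\<rfloor>)\<bar>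
            + \<bar>t - real (nat \<lfloor>t\<rfloor>)\<bar>" by argo
        moreover have "(nat \<lceil>s\<rceil>, nat \<lfloor>t\<rfloor>) \<in> ?I s \<times> ?I t" unfolding I by simp
        ultimately show ?thesis
          unfolding D by (intro image_eqI[of _ _ "(nat \<lceil>s\<rceil>, nat \<lfloor>t\<rfloor>)"]) (simp_all only: prod.case)
      next
        case st: False
        have "nat \<lceil>t\<rceil> \<le> nat \<lfloor>s\<rfloor>"
        proof (rule ccontr)
          assume "\<not> nat \<lceil>t\<rceil> \<le> nat \<lfloor>s\<rfloor>"
          then have "\<lfloor>s\<rfloor> = \<lfloor>t\<rfloor>" "\<lceil>s\<rceil> = \<lceil>t\<rceil>" using st s t by linarith+
          then show False using ne I by simp
        qed
        then have "real (nat \<lceil>t\<rceil>) \<le> real (nat \<lfloor>s\<rfloor>)" by (rule of_nat_mono)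
        moreover have "t \<le> real (nat \<lceil>t\<rceil>)" "real (nat \<lfloor>s\<rfloor>) \<le> s"
          using s t real_nat_ceiling_ge of_nat_floor by auto
        ultimately have "\<bar>s - t\<bar> = \<bar>s - real (nat \<lfloor>s\<rfloor>)\<bar> + \<bar>real (nat \<lfloor>s\<rfloor>) - real (nat \<lceil>t\<rceil>)\<bar>
            + \<bar>t - real (nat \<lceil>t\<rceil>)\<bar>" by argo
        moreover have "(nat \<lfloor>s\<rfloor>, nat \<lceil>t\<rceil>) \<in> ?I s \<times> ?I t" unfolding I by simp
        ultimately show ?thesis
          unfolding D by (intro image_eqI[of _ _ "(nat \<lfloor>s\<rfloor>, nat \<lceil>t\<rceil>)"]) (simp_all only: prod.case)
      qed
    qed
    then show ?thesis using False by (simp add: cayley_dist_def)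
  qed
qed

definition vertex_point :: "'a \<Rightarrow> 'a \<Rightarrow> real" where
  "vertex_point g v = (if v = g then 1 else 0)"

lemma support_vertex_point [simp]: "support (vertex_point g) = {g}"
  by (auto simp: support_def vertex_point_def)

lemma geodesic_point_nat:
  assumes x: "vertex_geodesic x n" and "i \<le> n"
  shows "geodesic_point x n (real i) = vertex_point (x i)"
proof
  fix v
  have "{j. j \<le> n \<and> \<bar>real i - real j\<bar> < 1} = {i}" using assms(2) by auto
  then have "support (geodesic_point x n (real i)) = {x i}"
    using support_geodesic_point[OF x, of "real i"] by simp
  moreover have "geodesic_point x n (real i) (x i) = 1"
    using geodesic_point_vertex[OF assms] by simp
  ultimately show "geodesic_point x n (real i) v = vertex_point (x i) v"
    by (cases "v = x i") (auto simp: vertex_point_def support_def)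
qed

lemma geodesic_segment_of_vertices:
  assumes x: "vertex_geodesic x n"
  shows "geodesic_segment (cayley_graph G S) (cayley_dist G S) (vertex_point (x 0)) (vertex_point (x n))
    (geodesic_point x n ` {0..real n})"
proof -
  let ?p = "geodesic_point x n"
  have e: "?p 0 = vertex_point (x 0)" "?p (real n) = vertex_point (x n)"
    using geodesic_point_nat[OF x, of 0] geodesic_point_nat[OF x, of n] by auto
  have "cayley_dist G S (vertex_point (x 0)) (vertex_point (x n)) = real n"
    using cayley_dist_geodesic_points[OF x, of 0 "real n"] e by simp
  then show ?thesis
    unfolding geodesic_segment_def using e cayley_dist_geodesic_points[OF x] geodesic_point_in_cayley_graph[OF x]
    by (intro exI[of _ ?p]) auto
qed

text \<open>A shortest path from a vertex to a point of an edge enters the edge through one of its end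
  points.  This is why triangles of vertices are thin with the same constant as triangles in the
  realization.\<close>

lemma near_vertex_of_near_point:
  assumes x: "vertex_geodesic x n" and t: "0 \<le> t" "t \<le> real n"
    and g: "g \<in> carrier G" and d: "cayley_dist G S (vertex_point g) (geodesic_point x n t) \<le> d" "0 \<le> d"
  shows "\<exists>j\<le>n. real (word_dist G S g (x j)) \<le> d"
proof -
  let ?q = "geodesic_point x n t"
  let ?I = "{i. i \<le> n \<and> \<bar>t - real i\<bar> < 1}"
  note supp = support_geodesic_point[OF x, of t]
  have I: "?I \<noteq> {}" "finite ?I" unfolding indices_near[OF t] by simp_all
  show ?thesis
  proof (cases "support ?q = {g}")
    case True
    then have "g \<in> x ` ?I" using supp by simp
    then obtain j where j: "j \<le> n" "x j = g" by blast
    have "word_dist G S g (x j) = 0" using g j(2) by simp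
    then show ?thesis using j(1) d(2) by auto
  next
    case False
    let ?D = "{(1 - vertex_point g u) + real (word_dist G S u v) + (1 - ?q v) | u v.
                 u \<in> {g} \<and> v \<in> support ?q}"
    let ?F = "(\<lambda>i. (1 - vertex_point g g) + real (word_dist G S g (x i)) + (1 - ?q (x i))) ` ?I"
    have "?D = ?F" unfolding supp by blast
    moreover have "Min ?F \<in> ?F" using I by (intro Min_in) auto
    ultimately obtain j where "j \<in> ?I"
      "Min ?D = (1 - vertex_point g g) + real (word_dist G S g (x j)) + (1 - ?q (x j))"
      by auto
    then have j: "j \<in> ?I" "Min ?D = real (word_dist G S g (x j)) + (1 - ?q (x j))"
      by (auto simp: vertex_point_def)
    have "?q (x j) \<le> 1" using geodesic_point_vertex[OF x] j(1) by simp
    moreover have "Min ?D \<le> d" using d(1) False by (auto simp: cayley_dist_def)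
    ultimately show ?thesis using j by (intro exI[of _ j]) auto
  qed
qed

lemma thin_vertex_triangle:
  assumes hyp: "hyperbolic_space \<delta> (cayley_graph G S) (cayley_dist G S)" and "0 \<le> \<delta>"
    and x: "vertex_geodesic x l" and y: "vertex_geodesic y m" and z: "vertex_geodesic z n"
    and ends: "x l = y 0" "y m = z 0" "z n = x 0" and i: "i \<le> l"
  shows "(\<exists>j\<le>m. real (word_dist G S (x i) (y j)) \<le> \<delta>) \<or> (\<exists>j\<le>n. real (word_dist G S (x i) (z j)) \<le> \<delta>)"
proof -
  have v: "vertex_point (u k) \<in> cayley_graph G S" if "vertex_geodesic u r" "k \<le> r" for u r k
    using geodesic_point_in_cayley_graph[OF that(1), of "real k"] geodesic_point_nat[OF that] that(2) by simp
  have segs: "geodesic_segment (cayley_graph G S) (cayley_dist G S) (vertex_point (x 0)) (vertex_point (y 0))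
       (geodesic_point x l ` {0..real l})"
    "geodesic_segment (cayley_graph G S) (cayley_dist G S) (vertex_point (y 0)) (vertex_point (z 0))
       (geodesic_point y m ` {0..real m})"
    "geodesic_segment (cayley_graph G S) (cayley_dist G S) (vertex_point (z 0)) (vertex_point (x 0))
       (geodesic_point z n ` {0..real n})"
    using geodesic_segment_of_vertices[OF x] geodesic_segment_of_vertices[OF y]
      geodesic_segment_of_vertices[OF z] ends by auto
  have "vertex_point (x i) \<in> geodesic_point x l ` {0..real l}"
    using geodesic_point_nat[OF x i] i by (auto simp: image_iff intro!: bexI[of _ "real i"])
  then obtain q where q: "q \<in> geodesic_point y m ` {0..real m} \<union> geodesic_point z n ` {0..real n}"
    "cayley_dist G S (vertex_point (x i)) q \<le> \<delta>"
    using hyp[unfolded hyperbolic_space_def, rule_format,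
        OF v[OF x le0] v[OF y le0] v[OF z le0] segs] by blast
  have xi: "x i \<in> carrier G" using x i by (auto simp: vertex_geodesic_def)
  from q(1) show ?thesis
  proof
    assume "q \<in> geodesic_point y m ` {0..real m}"
    then obtain t where "0 \<le> t" "t \<le> real m" "q = geodesic_point y m t" by auto
    then show ?thesis using near_vertex_of_near_point[OF y _ _ xi _ \<open>0 \<le> \<delta>\<close>] q(2) by blast
  next
    assume "q \<in> geodesic_point z n ` {0..real n}"
    then obtain t where "0 \<le> t" "t \<le> real n" "q = geodesic_point z n t" by auto
    then show ?thesis using near_vertex_of_near_point[OF z _ _ xi _ \<open>0 \<le> \<delta>\<close>] q(2) by blast
  qed
qed

section \<open>Bounded relators\<close>

lemma vertex_geodesic_of_shortest_word:
  assumes w: "w \<in> words S" "length w = word_length G S (word_eval G w)"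
  shows "vertex_geodesic (\<lambda>i. word_eval G (take i w)) (length w)"
proof -
  let ?x = "\<lambda>i. word_eval G (take i w)"
  have c: "?x i \<in> carrier G" for i using w words_take[of w S] by simp
  have le: "word_dist G S (?x i) (?x j) \<le> j - i" if "i \<le> j" for i j
  proof -
    have "take j w = take i w @ take (j - i) (drop i w)"
      using that by (metis le_add_diff_inverse take_add)
    moreover have m: "take (j - i) (drop i w) \<in> words S" using w words_take words_drop by metis
    ultimately have "?x j = ?x i \<otimes> word_eval G (take (j - i) (drop i w))"
      using eval_append words_take[of w S] w by metis
    then have "inv (?x i) \<otimes> ?x j = word_eval G (take (j - i) (drop i w))"
      using c[of i] m by (simp add: m_assoc[symmetric])
    then show ?thesis using word_length_eval_le[OF m] by (simp add: word_dist_def)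
  qed
  have eq: "word_dist G S (?x i) (?x j) = j - i" if "i \<le> j" "j \<le> length w" for i j
  proof -
    have "length w = word_dist G S (?x 0) (?x (length w))" using w c[of "length w"] by simp
    also have "\<dots> \<le> word_dist G S (?x 0) (?x i) + word_dist G S (?x i) (?x (length w))"
      by (rule word_dist_triangle[OF c c c])
    also have "\<dots> \<le> word_dist G S (?x 0) (?x i) +
        (word_dist G S (?x i) (?x j) + word_dist G S (?x j) (?x (length w)))"
      by (rule add_left_mono[OF word_dist_triangle[OF c c c]])
    finally show ?thesis
      using le[of 0 i] le[of i j] le[of j "length w"] that by linarith
  qed
  have "real (word_dist G S (?x i) (?x j)) = \<bar>real i - real j\<bar>" if "i \<le> length w" "j \<le> length w" for i j
  proof (cases "i \<le> j")
    case False
    then show ?thesis using eq[of j i] that word_dist_sym[OF c c, of i j] by simp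
  qed (use eq[of i j] that in simp)
  then show ?thesis using c by (simp add: vertex_geodesic_def)
qed

lemma vertex_geodesic_rev:
  "vertex_geodesic x n \<Longrightarrow> vertex_geodesic (\<lambda>i. x (n - i)) n"
  by (auto simp: vertex_geodesic_def of_nat_diff)

lemma vertex_geodesic_edge:
  assumes "g \<in> carrier G" "h \<in> carrier G" "word_dist G S g h \<le> 1"
  shows "vertex_geodesic (\<lambda>i. if i = 0 then g else h) (word_dist G S g h)"
proof (cases "g = h")
  case True
  then have "word_dist G S g h = 0" using assms by simp
  then show ?thesis using assms True by (simp add: vertex_geodesic_def)
next
  case False
  then have d: "word_dist G S g h = 1" using assms word_dist_eq_0[of g h] by linarith
  then have "word_dist G S h g = 1" "word_dist G S g g = 0" "word_dist G S h h = 0"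
    using assms word_dist_sym[of g h] by simp_all
  then show ?thesis using assms d unfolding vertex_geodesic_def by (auto simp: le_Suc_eq)
qed

text \<open>Consider the triangle with vertices $1$, $g$ and $h$, where $g$ and $h$ are the end points of
  the two geodesics.  The vertex \<open>x i\<close> of the first side lies within $\delta$ of a vertex \<open>z j\<close> of the
  second one or within $\delta + 1$ of $h$, which is also a vertex of the second one.  Comparing distances
  from $1$ shows that $i$ and $j$ differ by at most the same amount, so that \<open>z i\<close> is at most twice
  as far from \<open>x i\<close>.\<close>

lemma fellow_travel:
  assumes hyp: "hyperbolic_space \<delta> (cayley_graph G S) (cayley_dist G S)" and \<delta>: "0 \<le> \<delta>"
    and v: "v \<in> words S" "length v = word_length G S (word_eval G v)"
    and w: "w \<in> words S" "length w = word_length G S (word_eval G w)"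
    and adj: "word_dist G S (word_eval G v) (word_eval G w) \<le> 1"
  shows "real (word_dist G S (word_eval G (take i v)) (word_eval G (take i w))) \<le> 2 * \<delta> + 2"
proof -
  let ?x = "\<lambda>i. word_eval G (take i v)" and ?z = "\<lambda>i. word_eval G (take i w)"
  let ?g = "word_eval G v" and ?h = "word_eval G w"
  let ?l = "length v" and ?n = "length w"
  let ?m = "word_dist G S ?g ?h"
  let ?y = "\<lambda>i. if i = 0 then ?g else ?h"
  have x: "vertex_geodesic ?x ?l" and z: "vertex_geodesic ?z ?n"
    using vertex_geodesic_of_shortest_word v w by auto
  have cx: "?x i \<in> carrier G" and cz: "?z i \<in> carrier G" for i
    using v w words_take[of v S] words_take[of w S] by auto
  have cg: "?g \<in> carrier G" and ch: "?h \<in> carrier G" using v w by auto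
  have dz: "real (word_dist G S (?z i) (?z j)) = \<bar>real i - real j\<bar>" if "i \<le> ?n" "j \<le> ?n" for i j
    using z that by (auto simp: vertex_geodesic_def)
  have dz0: "real (word_dist G S \<one> (?z j)) = real j" if "j \<le> ?n" for j using dz[of 0 j] that by simp
  have dx0: "real (word_dist G S \<one> (?x j)) = real j" if "j \<le> ?l" for j
  proof -
    have "real (word_dist G S (?x 0) (?x j)) = \<bar>real 0 - real j\<bar>"
      using x that unfolding vertex_geodesic_def by blast
    then show ?thesis by simp
  qed
  have len: "?n \<le> ?l + 1"
    using word_dist_triangle[of \<one> ?g ?h] cg ch v(2) w(2) adj by simp
  \<comment> \<open>The index \<open>i\<close> may exceed \<open>?n\<close>; then \<open>?z i\<close> is the end point of the second side.\<close>
  have close: "real (word_dist G S (?x i) (?z i)) \<le> 2 * d"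
    if j: "j \<le> ?n" "real (word_dist G S (?x i) (?z j)) \<le> d" and i: "i \<le> ?l" for j d
  proof -
    have "word_dist G S \<one> (?x i) \<le> word_dist G S \<one> (?z j) + word_dist G S (?z j) (?x i)"
      "word_dist G S \<one> (?z j) \<le> word_dist G S \<one> (?x i) + word_dist G S (?x i) (?z j)"
      by (rule word_dist_triangle[OF one_closed cz cx] word_dist_triangle[OF one_closed cx cz])+
    then have ij: "\<bar>real i - real j\<bar> \<le> d"
      using dx0[OF i] dz0[OF j(1)] j(2) word_dist_sym[OF cx cz, of i j] by linarith
    have "?z i = ?z (min i ?n)" by (simp add: min_def)
    then have "real (word_dist G S (?z j) (?z i)) = \<bar>real j - real (min i ?n)\<bar>"
      using dz[OF j(1), of "min i ?n"] by simp
    also have "\<dots> \<le> d" using ij j(1) by (auto simp: min_def)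
    finally show ?thesis using word_dist_triangle[OF cx cz cz, of i i j] j(2) by linarith
  qed
  show ?thesis
  proof (cases "i \<le> ?l")
    case True
    have y: "vertex_geodesic ?y ?m"
      using adj by (rule vertex_geodesic_edge[OF cg ch])
    have ym: "?y ?m = ?h" using word_dist_eq_0[OF cg ch] by auto
    have "(\<exists>j\<le>?m. real (word_dist G S (?x i) (?y j)) \<le> \<delta>) \<or>
        (\<exists>j\<le>?n. real (word_dist G S (?x i) (?z (?n - j))) \<le> \<delta>)"
      using ym by (intro thin_vertex_triangle[OF hyp \<delta> x y vertex_geodesic_rev[OF z] _ _ _ True]) auto
    then show ?thesis
    proof
      assume "\<exists>j\<le>?m. real (word_dist G S (?x i) (?y j)) \<le> \<delta>"
      then have "real (word_dist G S (?x i) ?g) \<le> \<delta> \<or> real (word_dist G S (?x i) ?h) \<le> \<delta>" by (auto split: if_splits)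
      then have "real (word_dist G S (?x i) ?h) \<le> \<delta> + 1"
        using word_dist_triangle[OF cx cg ch, of i] adj by auto
      then show ?thesis using close[of ?n "\<delta> + 1"] True by simp
    next
      assume "\<exists>j\<le>?n. real (word_dist G S (?x i) (?z (?n - j))) \<le> \<delta>"
      then obtain j where "j \<le> ?n" "real (word_dist G S (?x i) (?z (?n - j))) \<le> \<delta>" by blast
      then show ?thesis using close[of "?n - j" \<delta>] True by simp
    qed
  next
    case False
    then have xi: "?x i = ?g" by simp
    have "?z i = ?h" using False len by simp
    then show ?thesis using xi adj \<delta> by simp
  qed
qed

end

text \<open>The claim that short relations generate all relations of $\Gamma = E / \ker p$ is stated in
  terms of a test homomorphism \<open>f\<close>, which avoids presentations and normal closures: if \<open>f\<close>
  kills the elements of $\ker p$ of length at most $4\delta + 6$, it kills $\ker p$.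

  A geodesic word \<open>\<gamma> g\<close> in the letters of \<open>T\<close> is fixed for each element \<open>g\<close> of $\Gamma$.
  The heart of the argument is that \<open>f\<close> sends $\gamma(g)\, c$ and $\gamma(g\, p(c))$ to the same
  element when \<open>c\<close> has length at most $1$.  The two geodesics are compared prefix by prefix:
  a rung of the ladder between them has length at most $2\delta + 2$, so two consecutive rungs,
  together with one letter of each geodesic, form a relation of length at most
  $2 (2\delta + 2) + 2 = 4\delta + 6$.  Reading a word \<open>w\<close> letter by letter then shows that its value
  and that of \<open>\<gamma> (p w)\<close> have the same image under \<open>f\<close>; if \<open>w\<close> is a relation, the latter is
  the image of the empty word.\<close>

lemma bounded_relators:
  assumes E: "generated_group E T" and G: "generated_group G S"
    and p: "p \<in> hom E G" "p ` T = S"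
    and hyp: "hyperbolic_space \<delta> (cayley_graph G S) (cayley_dist G S)" and \<delta>: "0 \<le> \<delta>"
    and H: "group H" and f: "f \<in> hom E H"
    and short: "\<And>e. e \<in> carrier E \<Longrightarrow> p e = \<one>\<^bsub>G\<^esub> \<Longrightarrow> real (word_length E T e) \<le> 4 * \<delta> + 6 \<Longrightarrow> f e = \<one>\<^bsub>H\<^esub>"
    and e: "e \<in> carrier E" "p e = \<one>\<^bsub>G\<^esub>"
  shows "f e = \<one>\<^bsub>H\<^esub>"
proof -
  interpret E: generated_group E T by fact
  interpret G: generated_group G S by fact
  interpret H: group H by fact
  interpret p: group_hom E G p
    using p by (simp add: group_hom_def group_hom_axioms_def E.is_group G.is_group)
  interpret f: group_hom E H f
    using f by (simp add: group_hom_def group_hom_axioms_def E.is_group H.is_group)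
  let ?len = "word_length E T"
  have same: "f a = f b" if "a \<in> carrier E" "b \<in> carrier E" "p a = p b" "real (?len a + ?len b) \<le> 4 * \<delta> + 6" for a b
  proof -
    have "f (a \<otimes>\<^bsub>E\<^esub> inv\<^bsub>E\<^esub> b) = \<one>\<^bsub>H\<^esub>"
      using that E.word_length_mult[of a "inv\<^bsub>E\<^esub> b"] by (intro short) (auto)
    then show ?thesis using that(1,2) by (simp add: H.inv_solve_right')
  qed
  have p_eval: "p (word_eval E w) = word_eval G (map (apsnd p) w)" if "w \<in> words T" for w
    using E.hom_word_eval[OF G.is_group p(1) E.generators_subset that] .
  have lift: "\<exists>w\<in>words T. length w = word_length G S g \<and> p (word_eval E w) = g" if "g \<in> carrier G" for g
  proof -
    obtain w where w: "w \<in> words S" "length w = word_length G S g" "word_eval G w = g"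
      using G.ex_shortest_word[OF \<open>g \<in> carrier G\<close>] .
    obtain v where "v \<in> words T" "map (apsnd p) v = w"
      using words_lift[of w p T] w(1) p(2) by auto
    then show ?thesis using w p_eval[of v] by (intro bexI[of _ v]) auto
  qed
  then obtain \<gamma> where \<gamma>: "\<And>g. g \<in> carrier G \<Longrightarrow> \<gamma> g \<in> words T"
    "\<And>g. g \<in> carrier G \<Longrightarrow> length (\<gamma> g) = word_length G S g"
    "\<And>g. g \<in> carrier G \<Longrightarrow> p (word_eval E (\<gamma> g)) = g" by metis
  have step: "f (word_eval E (\<gamma> (g \<otimes>\<^bsub>G\<^esub> p c))) = f (word_eval E (\<gamma> g)) \<otimes>\<^bsub>H\<^esub> f c"
    if g: "g \<in> carrier G" and c: "c \<in> carrier E" "?len c \<le> 1" for g c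
  proof -
    let ?h = "g \<otimes>\<^bsub>G\<^esub> p c"
    have h: "?h \<in> carrier G" using g c by simp
    let ?u = "\<lambda>i. word_eval E (take i (\<gamma> g))" and ?v = "\<lambda>i. word_eval E (take i (\<gamma> ?h))"
    have wt: "take i (\<gamma> g) \<in> words T" "take i (\<gamma> ?h) \<in> words T" for i
      using \<gamma>(1) g h words_take by metis+
    have cu: "?u i \<in> carrier E" and cv: "?v i \<in> carrier E" for i using wt by auto
    have "word_dist G S g ?h = word_length G S (p c)"
      using g c(1) by (simp add: word_dist_def G.m_assoc[symmetric])
    also have "\<dots> \<le> ?len c" by (rule word_length_image_le[OF E G p c(1)])
    finally have adj: "word_dist G S g ?h \<le> 1" using c(2) by simp
    have ft: "real (word_dist G S (p (?u i)) (p (?v i))) \<le> 2 * \<delta> + 2" for i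
    proof -
      have mw: "map (apsnd p) (\<gamma> k) \<in> words S" "word_eval G (map (apsnd p) (\<gamma> k)) = k"
        if "k \<in> carrier G" for k
        using \<gamma>[OF that] p_eval[of "\<gamma> k"] p(2) by (auto intro: words_map)
      show ?thesis
        using G.fellow_travel[OF hyp \<delta>, of "map (apsnd p) (\<gamma> g)" "map (apsnd p) (\<gamma> ?h)" i]
          mw[OF g] mw[OF h] \<gamma>(2)[OF g] \<gamma>(2)[OF h] adj p_eval[OF wt(1), of i] p_eval[OF wt(2), of i]
        by (simp add: take_map)
    qed
    \<comment> \<open>The rung \<open>a\<close> is arbitrary: the induction step chooses a short rung \<open>?b\<close> at the
      previous level, and the last rung is the given \<open>c\<close>.\<close>
    have main: "f (?v i) = f (?u i) \<otimes>\<^bsub>H\<^esub> f a"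
      if "a \<in> carrier E" "p (?v i) = p (?u i) \<otimes>\<^bsub>G\<^esub> p a" "real (?len a) \<le> 2 * \<delta> + 2" for i a
      using that
    proof (induction i arbitrary: a)
      case 0
      then have "f a = \<one>\<^bsub>H\<^esub>" using \<delta> by (intro short) auto
      then show ?case by simp
    next
      case (Suc i)
      obtain l where l: "l \<in> carrier E" "?len l \<le> 1" "?u (Suc i) = ?u i \<otimes>\<^bsub>E\<^esub> l"
        using E.word_eval_take_Suc[OF \<gamma>(1)[OF g]] by blast
      obtain r where r: "r \<in> carrier E" "?len r \<le> 1" "?v (Suc i) = ?v i \<otimes>\<^bsub>E\<^esub> r"
        using E.word_eval_take_Suc[OF \<gamma>(1)[OF h]] by blast
      let ?k = "inv\<^bsub>G\<^esub> p (?u i) \<otimes>\<^bsub>G\<^esub> p (?v i)"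
      have k: "?k \<in> carrier G" using cu cv by simp
      let ?b = "word_eval E (\<gamma> ?k)"
      have b: "?b \<in> carrier E" "p ?b = ?k" using \<gamma>[OF k] by auto
      have "?len ?b \<le> word_length G S ?k" using E.word_length_eval_le[OF \<gamma>(1)[OF k]] \<gamma>(2)[OF k] by simp
      then have lb: "real (?len ?b) \<le> 2 * \<delta> + 2" using ft[of i] by (simp add: word_dist_def)
      have pb: "p (?v i) = p (?u i) \<otimes>\<^bsub>G\<^esub> p ?b" using b cu cv by (simp add: G.m_assoc[symmetric])
      have IH: "f (?v i) = f (?u i) \<otimes>\<^bsub>H\<^esub> f ?b" using Suc.IH[OF b(1) pb lb] .
      have "f (?b \<otimes>\<^bsub>E\<^esub> r) = f (l \<otimes>\<^bsub>E\<^esub> a)"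
      proof (rule same)
        have "p (?u i) \<otimes>\<^bsub>G\<^esub> (p ?b \<otimes>\<^bsub>G\<^esub> p r) = p (?u i) \<otimes>\<^bsub>G\<^esub> (p l \<otimes>\<^bsub>G\<^esub> p a)"
          using Suc.prems(1,2) pb l r b cu cv by (simp add: G.m_assoc[symmetric])
        then have "p ?b \<otimes>\<^bsub>G\<^esub> p r = p l \<otimes>\<^bsub>G\<^esub> p a"
          using b(1) l(1) r(1) Suc.prems(1) cu by (subst (asm) G.l_cancel) auto
        then show "p (?b \<otimes>\<^bsub>E\<^esub> r) = p (l \<otimes>\<^bsub>E\<^esub> a)" using b(1) l(1) r(1) Suc.prems(1) by simp
        show "real (?len (?b \<otimes>\<^bsub>E\<^esub> r) + ?len (l \<otimes>\<^bsub>E\<^esub> a)) \<le> 4 * \<delta> + 6"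
          using E.word_length_mult[OF b(1) r(1)] E.word_length_mult[OF l(1) Suc.prems(1)]
            lb Suc.prems(3) l(2) r(2) by linarith
      qed (use b l r Suc.prems in auto)
      then show ?case using IH b l r Suc.prems(1) cu cv by (simp add: H.m_assoc)
    qed
    \<comment> \<open>An index beyond both lengths, at which both prefixes are the whole words.\<close>
    let ?N = "length (\<gamma> g) + length (\<gamma> ?h)"
    have "?u ?N = word_eval E (\<gamma> g)" "?v ?N = word_eval E (\<gamma> ?h)" by simp_all
    then show ?thesis using main[of c ?N] c \<gamma>(3)[OF g] \<gamma>(3)[OF h] \<delta> by simp
  qed
  have "f (word_eval E w) = f (word_eval E (\<gamma> (p (word_eval E w))))" if "w \<in> words T" for w
    using that
  proof (induction w rule: rev_induct)
    case Nil
    have "\<gamma> \<one>\<^bsub>G\<^esub> = []" using \<gamma>(2)[of "\<one>\<^bsub>G\<^esub>"] by simp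
    then show ?case by simp
  next
    case (snoc a w)
    let ?c = "word_eval E [a]"
    have w: "w \<in> words T" and a: "[a] \<in> words T" using snoc.prems by (cases a; simp)+
    have c: "?c \<in> carrier E" using a E.eval_closed by blast
    have cl: "?len ?c \<le> 1" using E.word_length_eval_le[OF a] by simp
    have "word_eval E w \<in> carrier E" using w by simp
    then show ?case
      using step[of "p (word_eval E w)" ?c] snoc.IH[OF w] c cl E.eval_append[OF w a] by simp
  qed
  moreover obtain w where "w \<in> words T" "word_eval E w = e" using E.ex_word[OF e(1)] by blast
  moreover have "\<gamma> \<one>\<^bsub>G\<^esub> = []" using \<gamma>(2)[of "\<one>\<^bsub>G\<^esub>"] by simp
  ultimately show ?thesis using e(2) by force
qed

lemma factor_through_epi:
  assumes E: "group E" and G: "group G" and H: "group H"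
    and p: "p \<in> hom E G" "p ` carrier E = carrier G" and f: "f \<in> hom E H"
    and ker: "\<And>e. e \<in> carrier E \<Longrightarrow> p e = \<one>\<^bsub>G\<^esub> \<Longrightarrow> f e = \<one>\<^bsub>H\<^esub>"
  shows "\<exists>\<psi>\<in>hom G H. \<forall>e\<in>carrier E. \<psi> (p e) = f e"
proof -
  interpret E: group E by fact
  interpret H: group H by fact
  interpret p: group_hom E G p using assms by (simp add: group_hom_def group_hom_axioms_def)
  interpret f: group_hom E H f using assms by (simp add: group_hom_def group_hom_axioms_def)
  have wd: "f a = f b" if "a \<in> carrier E" "b \<in> carrier E" "p a = p b" for a b
  proof -
    have "f (a \<otimes>\<^bsub>E\<^esub> inv\<^bsub>E\<^esub> b) = \<one>\<^bsub>H\<^esub>" using that by (intro ker) auto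
    then show ?thesis using that(1,2) by (simp add: H.inv_solve_right')
  qed
  define \<psi> where "\<psi> g = f (inv_into (carrier E) p g)" for g
  have \<psi>: "\<psi> (p e) = f e" if "e \<in> carrier E" for e
    unfolding \<psi>_def using that by (intro wd inv_into_into f_inv_into_f) auto
  have "\<psi> \<in> hom G H"
  proof (rule homI)
    fix x y assume "x \<in> carrier G" "y \<in> carrier G"
    then obtain a b where ab: "a \<in> carrier E" "b \<in> carrier E" "x = p a" "y = p b"
      using p(2) by (metis imageE)
    then show "\<psi> x \<in> carrier H" by (simp add: \<psi>)
    show "\<psi> (x \<otimes>\<^bsub>G\<^esub> y) = \<psi> x \<otimes>\<^bsub>H\<^esub> \<psi> y"
      using ab \<psi>[of "a \<otimes>\<^bsub>E\<^esub> b"] by (simp add: \<psi>)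
  qed
  then show ?thesis using \<psi> by blast
qed

section \<open>Free groups\<close>

lemma not_reducedE:
  assumes "\<not> reduced w"
  obtains u v b x where "w = u @ [(b, x), (\<not> b, x)] @ v"
proof -
  have "\<exists>u v b x. w = u @ [(b, x), (\<not> b, x)] @ v" using assms
  proof (induction w rule: induct_list012)
    case (3 y z zs)
    obtain b x c x' where yz: "y = (b, x)" "z = (c, x')" by force
    show ?case
    proof (cases "x = x' \<and> b \<noteq> c")
      case True
      then have "y # z # zs = [] @ [(b, x), (\<not> b, x)] @ zs" using yz by auto
      then show ?thesis by blast
    next
      case False
      then have "\<not> reduced (z # zs)" using "3.prems" yz by (simp add: reduced_def successively.simps(3))
      then obtain u v b' x'' where "z # zs = u @ [(b', x''), (\<not> b', x'')] @ v" using "3.IH"(2) by blast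
      then show ?thesis by (metis append_Cons)
    qed
  qed (auto simp: reduced_def)
  then show ?thesis using that by blast
qed

text \<open>Cancelling a pair of inverse letters changes neither the value of a word nor the value of its
  image under a substitution of the letters.  Uniqueness of the reduced word in a free group thus
  makes the substitution well defined on group elements.\<close>

lemma ex_reduced_word:
  fixes G :: "('a, 'm) monoid_scheme" and H :: "('b, 'n) monoid_scheme"
  assumes G: "group G" "S \<subseteq> carrier G" and H: "group H" "f ` S \<subseteq> carrier H" and w: "w \<in> words S"
  shows "\<exists>v\<in>words S. reduced v \<and> word_eval G v = word_eval G w \<and>
    word_eval H (map (apsnd f) v) = word_eval H (map (apsnd f) w)"
  using w
proof (induction w rule: length_induct)
  case (1 w)
  interpret G: group G by fact
  interpret H: group H by fact
  show ?case
  proof (cases "reduced w")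
    case False
    then obtain u v b x where eq: "w = u @ [(b, x), (\<not> b, x)] @ v" by (rule not_reducedE)
    have uv: "u \<in> words S" "v \<in> words S" "x \<in> S" "[(b, x), (\<not> b, x)] \<in> words S" using 1(2) eq by auto
    have m: "map (apsnd f) z \<in> words (f ` S)" if "z \<in> words S" for z using that by (rule words_map) auto
    have x: "x \<in> carrier G" "f x \<in> carrier H" using uv G H by auto
    have "word_eval G w = word_eval G (u @ v)"
      unfolding eq using uv x by (cases b) (simp_all add: G.word_eval_append[OF G(2)] G.m_assoc[symmetric] G(2))
    moreover have "word_eval H (map (apsnd f) w) = word_eval H (map (apsnd f) (u @ v))"
      unfolding eq map_append using uv x m[OF uv(1)] m[OF uv(2)]
      by (cases b) (simp_all add: H.word_eval_append[OF H(2)] H.m_assoc[symmetric] H(2))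
    moreover have "length (u @ v) < length w" "u @ v \<in> words S" using eq uv by auto
    ultimately show ?thesis using 1(1) by metis
  qed (use 1 in auto)
qed

lemma free_group_extend:
  fixes H :: "('b, 'n) monoid_scheme"
  assumes free: "free_group_with_basis G S" and H: "group H" and f: "f ` S \<subseteq> carrier H"
  shows "\<exists>h\<in>hom G H. \<forall>s\<in>S. h s = f s"
proof -
  have G: "group G" "S \<subseteq> carrier G"
    and nf: "\<And>g. g \<in> carrier G \<Longrightarrow> \<exists>!w. w \<in> words S \<and> reduced w \<and> word_eval G w = g"
    using free by (auto simp: free_group_with_basis_def)
  interpret G: group G by fact
  interpret H: group H by fact
  define h where "h g = word_eval H (map (apsnd f) (THE w. w \<in> words S \<and> reduced w \<and> word_eval G w = g))" for g
  have h: "h (word_eval G w) = word_eval H (map (apsnd f) w)" if w: "w \<in> words S" for w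
  proof -
    obtain v where v: "v \<in> words S" "reduced v" "word_eval G v = word_eval G w"
      "word_eval H (map (apsnd f) v) = word_eval H (map (apsnd f) w)"
      using ex_reduced_word[OF G H f w] by blast
    have "(THE u. u \<in> words S \<and> reduced u \<and> word_eval G u = word_eval G w) = v"
      using v(1-3) by (intro the1_equality[OF nf[OF G.word_eval_closed[OF w G(2)]]]) simp
    then show ?thesis using v(4) by (simp add: h_def)
  qed
  have m: "map (apsnd f) w \<in> words (f ` S)" if "w \<in> words S" for w using that by (rule words_map) auto
  have "h \<in> hom G H"
  proof (rule homI)
    fix a b assume "a \<in> carrier G" "b \<in> carrier G"
    then obtain v w where vw: "v \<in> words S" "word_eval G v = a" "w \<in> words S" "word_eval G w = b"
      using nf by metis
    show "h a \<in> carrier H" using h[OF vw(1)] vw(2) H.word_eval_closed[OF m[OF vw(1)] f] by simp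
    have "a \<otimes>\<^bsub>G\<^esub> b = word_eval G (v @ w)" using vw G.word_eval_append[OF G(2)] by simp
    then have "h (a \<otimes>\<^bsub>G\<^esub> b) = word_eval H (map (apsnd f) v @ map (apsnd f) w)"
      using h[of "v @ w"] vw by simp
    then show "h (a \<otimes>\<^bsub>G\<^esub> b) = h a \<otimes>\<^bsub>H\<^esub> h b"
      using h[OF vw(1)] h[OF vw(3)] vw(2,4) H.word_eval_append[OF f m[OF vw(1)] m[OF vw(3)]] by simp
  qed
  moreover have "h s = f s" if "s \<in> S" for s
  proof -
    have "s \<in> carrier G" "f s \<in> carrier H" using that G f by auto
    then show ?thesis using h[of "[(True, s)]"] that by simp
  qed
  ultimately show ?thesis by blast
qed

section \<open>Lifting endomorphisms along the approximating sequence\<close>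

context lacunary_hyperbolic
begin

lemma generated_Gr: "generated_group (Gr k) (Sr k)"
  using group_Gr generating_Gr by (simp add: generated_group_def generated_group_axioms_def)

lemma \<alpha>_hom: "\<alpha> k \<in> hom (Gr k) (Gr (Suc k))"
  using \<alpha>_epi[of k] by (simp add: epi_def)

lemma \<eta>_hom: "\<eta> k \<in> hom (Gr k) G"
  using direct_limit by (simp add: is_direct_limit_def)

lemma projection_hom: "transition \<alpha> 0 k \<in> hom (Gr 0) (Gr k)"
proof (induction k)
  case 0
  then show ?case by (auto simp: hom_def)
next
  case (Suc k)
  then show ?case using hom_compose[OF Suc \<alpha>_hom[of k]] by (simp add: comp_def)
qed

lemma projection_surj: "transition \<alpha> 0 k ` carrier (Gr 0) = carrier (Gr k)"
proof (induction k)
  case (Suc k)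
  have "\<alpha> k ` carrier (Gr k) = carrier (Gr (Suc k))" using \<alpha>_epi[of k] by (simp add: epi_def)
  then show ?case using Suc by (simp only: transition.simps add_0 image_comp[symmetric])
qed simp

lemma projection_generators: "transition \<alpha> 0 k ` Sr 0 = Sr k"
proof (induction k)
  case (Suc k)
  then show ?case using \<alpha>_generators[of k] by (simp only: transition.simps add_0 image_comp[symmetric])
qed simp

lemma \<eta>_projection:
  assumes "x \<in> carrier (Gr 0)"
  shows "\<eta> k (transition \<alpha> 0 k x) = \<eta> 0 x"
proof -
  have "\<And>k x. x \<in> carrier (Gr k) \<Longrightarrow> \<eta> (Suc k) (\<alpha> k x) = \<eta> k x"
    using direct_limit by (simp add: is_direct_limit_def)
  from transition_compatible[of \<alpha> Gr \<eta>, OF \<alpha>_hom this assms, of k] show ?thesis by simp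
qed

lemma \<eta>_0_surj: "\<eta> 0 ` carrier (Gr 0) = carrier G"
proof -
  have "\<eta> k ` carrier (Gr k) = \<eta> 0 ` carrier (Gr 0)" for k
    unfolding projection_surj[of k, symmetric] image_image by (intro image_cong) (simp_all add: \<eta>_projection)
  then have "(\<Union>k. \<eta> k ` carrier (Gr k)) = \<eta> 0 ` carrier (Gr 0)" by blast
  then show ?thesis using direct_limit unfolding is_direct_limit_def by argo
qed

lemma eventually_injective_linear:
  "eventually (\<lambda>k. \<forall>g\<in>carrier (Gr k). real (word_length (Gr k) (Sr k) g) \<le> c * \<delta> k \<longrightarrow>
     \<eta> k g = \<one>\<^bsub>G\<^esub> \<longrightarrow> g = \<one>\<^bsub>Gr k\<^esub>) sequentially"
proof -
  let ?inj = "\<lambda>k. injectivity_radius (Gr k) (Sr k) (\<eta> k)"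
  have "eventually (\<lambda>k. ereal c < ereal_of_enat (?inj k) / ereal (\<delta> k)) sequentially"
    using injectivity by (simp add: tendsto_PInfty)
  then show ?thesis
  proof (rule eventually_mono, intro ballI impI)
    fix k g
    assume k: "ereal c < ereal_of_enat (?inj k) / ereal (\<delta> k)" and g: "g \<in> carrier (Gr k)"
      and len: "real (word_length (Gr k) (Sr k) g) \<le> c * \<delta> k" and triv: "\<eta> k g = \<one>\<^bsub>G\<^esub>"
    interpret K: generated_group "Gr k" "Sr k" by (rule generated_Gr)
    have "enat (word_length (Gr k) (Sr k) g) < ?inj k"
    proof (cases "?inj k")
      case (enat N)
      then have "c < real N / \<delta> k" using k \<delta>_pos[of k] by simp
      then have "c * \<delta> k < real N" using \<delta>_pos[of k] by (simp add: pos_less_divide_eq)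
      then show ?thesis using len enat by simp
    qed simp
    then obtain R where R: "word_length (Gr k) (Sr k) g < R"
      "\<forall>h\<in>carrier (Gr k). inj_on (\<eta> k) (word_ball (Gr k) (Sr k) h R)"
      unfolding injectivity_radius_def less_Sup_iff by auto
    have "g \<in> word_ball (Gr k) (Sr k) \<one>\<^bsub>Gr k\<^esub> R" "\<one>\<^bsub>Gr k\<^esub> \<in> word_ball (Gr k) (Sr k) \<one>\<^bsub>Gr k\<^esub> R"
      using g R(1) by (auto simp: word_ball_def)
    moreover have "\<eta> k g = \<eta> k \<one>\<^bsub>Gr k\<^esub>" using triv hom_one[OF \<eta>_hom group_Gr group_G] by simp
    ultimately show "g = \<one>\<^bsub>Gr k\<^esub>" using R(2) by (meson K.one_closed inj_onD)
  qed
qed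

lemma eventually_trivial:
  assumes e: "e \<in> carrier (Gr 0)" "\<eta> 0 e = \<one>\<^bsub>G\<^esub>"
  shows "eventually (\<lambda>k. transition \<alpha> 0 k e = \<one>\<^bsub>Gr k\<^esub>) sequentially"
proof -
  interpret F: group "Gr 0" by (rule group_Gr)
  have one: "transition \<alpha> 0 k \<one>\<^bsub>Gr 0\<^esub> = \<one>\<^bsub>Gr k\<^esub>" for k
    by (rule hom_one[OF projection_hom group_Gr group_Gr])
  have "\<eta> 0 e = \<eta> 0 \<one>\<^bsub>Gr 0\<^esub>" using e(2) hom_one[OF \<eta>_hom group_Gr group_G] by simp
  moreover have "\<And>x y. x \<in> carrier (Gr 0) \<Longrightarrow> y \<in> carrier (Gr 0) \<Longrightarrow> \<eta> 0 x = \<eta> 0 y \<Longrightarrow>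
      \<exists>j. transition \<alpha> 0 j x = transition \<alpha> 0 j y"
    using direct_limit unfolding is_direct_limit_def by blast
  ultimately obtain j where j: "transition \<alpha> 0 j e = transition \<alpha> 0 j \<one>\<^bsub>Gr 0\<^esub>"
    using e(1) by blast
  have "transition \<alpha> 0 k e = transition \<alpha> 0 k \<one>\<^bsub>Gr 0\<^esub>" if "j \<le> k" for k
    using that by (induction k rule: dec_induct) (simp_all add: j)
  then show ?thesis unfolding eventually_sequentially one by blast
qed

lemma ex_free_lift:
  assumes \<phi>: "\<phi> \<in> hom G G"
  shows "\<exists>\<phi>\<^sub>0\<in>hom (Gr 0) (Gr 0). \<forall>x\<in>carrier (Gr 0). \<eta> 0 (\<phi>\<^sub>0 x) = \<phi> (\<eta> 0 x)"
proof -
  interpret F: generated_group "Gr 0" "Sr 0" by (rule generated_Gr)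
  have "\<exists>x\<in>carrier (Gr 0). \<eta> 0 x = \<phi> (\<eta> 0 s)" if "s \<in> Sr 0" for s
  proof -
    have "\<phi> (\<eta> 0 s) \<in> \<eta> 0 ` carrier (Gr 0)"
      unfolding \<eta>_0_surj using that F.generators_subset hom_in_carrier[OF \<phi>] hom_in_carrier[OF \<eta>_hom] by blast
    then show ?thesis by force
  qed
  then obtain f where f: "\<And>s. s \<in> Sr 0 \<Longrightarrow> f s \<in> carrier (Gr 0)" "\<And>s. s \<in> Sr 0 \<Longrightarrow> \<eta> 0 (f s) = \<phi> (\<eta> 0 s)"
    by metis
  have "f ` Sr 0 \<subseteq> carrier (Gr 0)" using f(1) by blast
  from free_group_extend[OF free group_Gr this] obtain h
    where h: "h \<in> hom (Gr 0) (Gr 0)" "\<And>s. s \<in> Sr 0 \<Longrightarrow> h s = f s" by blast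
  have "\<eta> 0 (h x) = \<phi> (\<eta> 0 x)" if x: "x \<in> carrier (Gr 0)" for x
  proof -
    obtain w where w: "w \<in> words (Sr 0)" "word_eval (Gr 0) w = x" using F.ex_word[OF x] by blast
    have "map (apsnd (\<eta> 0 \<circ> h)) w = map (apsnd (\<phi> \<circ> \<eta> 0)) w"
    proof (rule map_cong[OF refl])
      fix a assume "a \<in> set w"
      then have "snd a \<in> Sr 0" using w(1) by (auto simp: words_def)
      then show "apsnd (\<eta> 0 \<circ> h) a = apsnd (\<phi> \<circ> \<eta> 0) a" by (cases a) (simp add: f h)
    qed
    then have "(\<eta> 0 \<circ> h) x = (\<phi> \<circ> \<eta> 0) x"
      using F.hom_word_eval[OF group_G hom_compose[OF h(1) \<eta>_hom] F.generators_subset w(1)]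
        F.hom_word_eval[OF group_G hom_compose[OF \<eta>_hom \<phi>] F.generators_subset w(1)] w(2) by argo
    then show ?thesis by simp
  qed
  then show ?thesis using h(1) by blast
qed

text \<open>The constant $10$ serves both ranges of $\delta_k$: the bound $4\delta_k + 6$ on the relations is
  at most $10$ if $\delta_k \le 1$ and at most $10\delta_k$ otherwise.\<close>

lemma ex_coherent_lift:
  assumes \<phi>: "\<phi> \<in> hom G G"
  shows "\<exists>n. coherently_lifts Gr \<alpha> \<eta> n \<phi>"
proof -
  interpret F: generated_group "Gr 0" "Sr 0" by (rule generated_Gr)
  obtain \<phi>\<^sub>0 where \<phi>\<^sub>0: "\<phi>\<^sub>0 \<in> hom (Gr 0) (Gr 0)"
    and lift: "\<And>x. x \<in> carrier (Gr 0) \<Longrightarrow> \<eta> 0 (\<phi>\<^sub>0 x) = \<phi> (\<eta> 0 x)"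
    using ex_free_lift[OF \<phi>] by blast
  have c0: "\<phi>\<^sub>0 x \<in> carrier (Gr 0)" if "x \<in> carrier (Gr 0)" for x using hom_in_carrier[OF \<phi>\<^sub>0 that] .
  \<comment> \<open>Inserting \<open>0\<close> covers the case of an empty basis.\<close>
  define L where "L = Max (insert 0 ((\<lambda>s. word_length (Gr 0) (Sr 0) (\<phi>\<^sub>0 s)) ` Sr 0))"
  have L: "word_length (Gr 0) (Sr 0) (\<phi>\<^sub>0 s) \<le> L" if "s \<in> Sr 0" for s
    unfolding L_def using that F.generators_finite by (intro Max_ge) auto
  let ?\<pi> = "transition \<alpha> 0"
  let ?B = "{e \<in> carrier (Gr 0). word_length (Gr 0) (Sr 0) e \<le> 10}"
  have "eventually (\<lambda>k. \<forall>e\<in>?B. \<eta> 0 (\<phi>\<^sub>0 e) = \<one>\<^bsub>G\<^esub> \<longrightarrow> ?\<pi> k (\<phi>\<^sub>0 e) = \<one>\<^bsub>Gr k\<^esub>) sequentially"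
  proof (rule eventually_ball_finite[OF F.finite_word_length_le], intro ballI)
    fix e assume "e \<in> ?B"
    then show "eventually (\<lambda>k. \<eta> 0 (\<phi>\<^sub>0 e) = \<one>\<^bsub>G\<^esub> \<longrightarrow> ?\<pi> k (\<phi>\<^sub>0 e) = \<one>\<^bsub>Gr k\<^esub>) sequentially"
      using eventually_trivial[of "\<phi>\<^sub>0 e"] c0 by (cases "\<eta> 0 (\<phi>\<^sub>0 e) = \<one>\<^bsub>G\<^esub>") simp_all
  qed
  from eventually_conj[OF this eventually_injective_linear[of "10 * real L"]] obtain n where
    short: "\<And>k e. n \<le> k \<Longrightarrow> e \<in> ?B \<Longrightarrow> \<eta> 0 (\<phi>\<^sub>0 e) = \<one>\<^bsub>G\<^esub> \<Longrightarrow> ?\<pi> k (\<phi>\<^sub>0 e) = \<one>\<^bsub>Gr k\<^esub>"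
    and long: "\<And>k g. n \<le> k \<Longrightarrow> g \<in> carrier (Gr k) \<Longrightarrow>
      real (word_length (Gr k) (Sr k) g) \<le> 10 * real L * \<delta> k \<Longrightarrow> \<eta> k g = \<one>\<^bsub>G\<^esub> \<Longrightarrow> g = \<one>\<^bsub>Gr k\<^esub>"
    unfolding eventually_sequentially by blast
  have "\<exists>\<psi>\<in>hom (Gr k) (Gr k). \<forall>x\<in>carrier (Gr 0). \<psi> (?\<pi> k x) = ?\<pi> k (\<phi>\<^sub>0 x)" if k: "n \<le> k" for k
  proof -
    have f: "?\<pi> k \<circ> \<phi>\<^sub>0 \<in> hom (Gr 0) (Gr k)" by (rule hom_compose[OF \<phi>\<^sub>0 projection_hom])
    have fL: "word_length (Gr k) (Sr k) ((?\<pi> k \<circ> \<phi>\<^sub>0) s) \<le> L" if "s \<in> Sr 0" for s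
    proof -
      have "\<phi>\<^sub>0 s \<in> carrier (Gr 0)" using that F.generators_subset by (intro c0) blast
      from word_length_image_le[OF generated_Gr generated_Gr projection_hom projection_generators this, of k]
      show ?thesis using L[OF that] by simp
    qed
    have "(?\<pi> k \<circ> \<phi>\<^sub>0) e = \<one>\<^bsub>Gr k\<^esub>"
      if e: "e \<in> carrier (Gr 0)" "?\<pi> k e = \<one>\<^bsub>Gr k\<^esub>"
        and len: "real (word_length (Gr 0) (Sr 0) e) \<le> 4 * \<delta> k + 6" for e
    proof -
      have "\<eta> 0 e = \<one>\<^bsub>G\<^esub>"
        using \<eta>_projection[OF e(1), of k] e(2) hom_one[OF \<eta>_hom group_Gr group_G] by simp
      then have triv: "\<eta> 0 (\<phi>\<^sub>0 e) = \<one>\<^bsub>G\<^esub>"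
        using lift[OF e(1)] hom_one[OF \<phi> group_G group_G] by simp
      show ?thesis
      proof (cases "\<delta> k \<le> 1")
        case True
        then have "e \<in> ?B" using e(1) len by simp
        then show ?thesis using short[OF k _ triv] by simp
      next
        case False
        have "real (word_length (Gr k) (Sr k) ((?\<pi> k \<circ> \<phi>\<^sub>0) e)) \<le> real L * real (word_length (Gr 0) (Sr 0) e)"
          using word_length_hom_le[OF generated_Gr generated_Gr f fL e(1)] by (simp flip: of_nat_mult)
        also have "\<dots> \<le> real L * (10 * \<delta> k)" using len False by (intro mult_left_mono) auto
        finally have "real (word_length (Gr k) (Sr k) ((?\<pi> k \<circ> \<phi>\<^sub>0) e)) \<le> 10 * real L * \<delta> k" by simp
        moreover have "\<eta> k ((?\<pi> k \<circ> \<phi>\<^sub>0) e) = \<one>\<^bsub>G\<^esub>" using \<eta>_projection[OF c0[OF e(1)]] triv by simp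
        ultimately show ?thesis using long[OF k hom_in_carrier[OF f e(1)]] by blast
      qed
    qed
    from bounded_relators[OF generated_Gr generated_Gr projection_hom projection_generators hyperbolic
        less_imp_le[OF \<delta>_pos] group_Gr f this]
    have ker: "(?\<pi> k \<circ> \<phi>\<^sub>0) e = \<one>\<^bsub>Gr k\<^esub>" if "e \<in> carrier (Gr 0)" "?\<pi> k e = \<one>\<^bsub>Gr k\<^esub>" for e
      using that by blast
    from factor_through_epi[OF group_Gr group_Gr group_Gr projection_hom projection_surj f ker]
    show ?thesis by simp
  qed
  then show ?thesis unfolding coherently_lifts_def using \<phi>\<^sub>0 lift by blast
qed

end

theorem corollary3p5:
  fixes G :: "('b, 'n) monoid_scheme" and S :: "'b set"
    and Gr :: "nat \<Rightarrow> ('a, 'm) monoid_scheme" and Sr :: "nat \<Rightarrow> 'a set"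
    and \<alpha> :: "nat \<Rightarrow> 'a \<Rightarrow> 'a" and \<eta> :: "nat \<Rightarrow> 'a \<Rightarrow> 'b" and \<delta> :: "nat \<Rightarrow> real"
  assumes "lacunary_hyperbolic G S Gr Sr \<alpha> \<eta> \<delta>"
  shows "(\<forall>\<phi>\<in>Mor G. \<exists>n. coherently_lifts Gr \<alpha> \<eta> n \<phi>) \<and>
         Mor G = (\<Union>n. Mor_step G Gr \<alpha> \<eta> n) \<and>
         OMor G = (\<Union>n. OMor_step G Gr \<alpha> \<eta> n)"
proof -
  have lift: "\<forall>\<phi>\<in>Mor G. \<exists>n. coherently_lifts Gr \<alpha> \<eta> n \<phi>"
    using lacunary_hyperbolic.ex_coherent_lift[OF assms] by (simp add: Mor_def)
  then have Mor: "Mor G = (\<Union>n. Mor_step G Gr \<alpha> \<eta> n)"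
    by (auto simp: Mor_step_def)
  have "OMor G = (\<lambda>\<phi>. inner_rel G `` {\<phi>}) ` Mor G"
    by (auto simp: OMor_def quotient_def)
  also have "\<dots> = (\<Union>n. OMor_step G Gr \<alpha> \<eta> n)"
    unfolding OMor_step_def by (subst Mor) (rule image_UN)
  finally show ?thesis using lift Mor by blast
qed

end
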